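(* There is an absolute constant $C$ such that for every integer $N\ge 2$, every collection $\Sigma\subset S^2$ of $N$ unit vectors, and every $F\in L^2(\mathbb{R}^3)$, $$\|M_0^\Sigma F\|_{L^2(\mathbb{R}^3)}\le C\, N^{1/4}\,(\log N)\,\|F\|_{L^2(\mathbb{R}^3)}.$$
   Context: $S^2$ is the unit sphere in $\mathbb{R}^3$. For a finite set $\Sigma\subset S^2$ and $F:\mathbb{R}^3\to\mathbb{R}$, the maximal operator of averages at scale $1$ along the directions in $\Sigma$ is $$M_0^\Sigma F(\mathbf{x})=\max_{\mathbf{v}\in\Sigma}\left|\int_{-1/2}^{1/2}F(\mathbf{x}+t\mathbf{v})\,dt\right|,$$ defined for almost every $\mathbf{x}\in\mathbb{R}^3$. *)

theory Defs
  imports "HOL-Analysis.Analysis"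
begin

text \<open>
  Members of \<open>L2\<close> are individual functions, not classes modulo null sets; measurability is with
  respect to the Lebesgue (completed) \<open>\<sigma>\<close>-algebra.
\<close>

definition L2 :: "('a::euclidean_space \<Rightarrow> real) set" where
  "L2 = {f. f \<in> borel_measurable lebesgue \<and> integrable lebesgue (\<lambda>x. (f x)\<^sup>2)}"

text \<open>Meaningful on \<open>L2\<close> only: elsewhere the Bochner integral may default to 0.\<close>

definition L2_norm :: "('a::euclidean_space \<Rightarrow> real) \<Rightarrow> real" where
  "L2_norm f = sqrt (\<integral>x. (f x)\<^sup>2 \<partial>lebesgue)"

text \<open>
  For \<open>F\<close> in \<open>L2\<close> and finite \<open>\<Sigma>\<close>, the line integrals exist for all \<open>v\<close> in \<open>\<Sigma>\<close> at almost every
  \<open>x\<close>; at the other \<open>x\<close>, any nonexistent integral has the default value 0.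
\<close>

definition M0 :: "(real ^ 3) set \<Rightarrow> (real ^ 3 \<Rightarrow> real) \<Rightarrow> real ^ 3 \<Rightarrow> real" where
  "M0 \<Sigma> F x = Max ((\<lambda>v. \<bar>LINT t:{-1/2..1/2}|lebesgue. F (x + t *\<^sub>R v)\<bar>) ` \<Sigma>)"

end

theory Submission
  imports Defs
begin

text \<open>
  By duality one bounds \<open>T g = \<Sum>\<^sub>v A\<^sub>v g\<^sub>v\<close>, where \<open>A\<^sub>v\<close> averages over segments in direction \<open>v\<close>
  and \<open>g = \<Sum>\<^sub>v g\<^sub>v\<close> with \<open>g\<^sub>v \<ge> 0\<close>. As \<open>A\<^sub>v\<close> is self-adjoint, \<open>\<parallel>T g\<parallel>\<^sup>2\<close> is the sum of the
  \<open>\<langle>g\<^sub>v, A\<^sub>v T g\<rangle>\<close>, hence at most \<open>N\<close> to the power \<open>1/2\<close> times \<open>\<parallel>g\<parallel> max\<^sub>v \<parallel>A\<^sub>v T g\<parallel>\<close>. For fixed \<open>v\<close>,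
  the average \<open>A\<^sub>v A\<^sub>w\<close> over a parallelogram is dominated by \<open>2 A\<^sub>2\<^sub>v A\<^sub>u\<close>, where \<open>u\<close> is the component of \<open>w\<close>
  orthogonal to \<open>v\<close>. So \<open>\<parallel>A\<^sub>v T g\<parallel>\<close> is controlled by a family of segments of different lengths in
  a plane, for which the norm is \<open>O(log N)\<close> (a form of a theorem of Katz): split the directions at the median slope;
  the cross terms between the halves are dominated using averages in two fixed directions, so that
  the norm grows by an additive constant when the number of directions doubles. This gives
  \<open>\<parallel>T\<parallel>\<^sup>2 = O(sqrt N log N)\<close>.
\<close>

section \<open>Averages over segments\<close>

lemma ennreal_le_of_power2_le:
  fixes x y :: ennreal
  assumes "x\<^sup>2 \<le> y\<^sup>2"
  shows "x \<le> y"
proof (cases "y = top")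
  case False
  then show ?thesis
    using assms
    by (cases x; cases y) (auto simp: ennreal_power ennreal_le_iff2 power_less_zero_eq top_unique
        dest: power2_le_imp_le)
qed simp

text \<open>The vector \<open>z\<close> carries direction and length together; the total mass is 1
  for every \<open>z\<close>, and \<open>z = 0\<close> gives the identity. Values in
  \<open>ennreal\<close> let Fubini and duality run without integrability conditions.\<close>

definition seg_avg :: "'a::euclidean_space \<Rightarrow> ('a \<Rightarrow> ennreal) \<Rightarrow> 'a \<Rightarrow> ennreal" where
  "seg_avg z f x = (\<integral>\<^sup>+t. f (x + t *\<^sub>R z) * indicator {-1/2..1/2} t \<partial>lborel)"

lemma borel_measurable_seg_avg [measurable]:
  fixes z :: "'a::euclidean_space"
  assumes [measurable]: "f \<in> borel_measurable borel"
  shows "seg_avg z f \<in> borel_measurable borel"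
  unfolding seg_avg_def by measurable

lemma nn_integral_lborel_translate:
  fixes a :: "'a::euclidean_space"
  assumes [measurable]: "f \<in> borel_measurable borel"
  shows "(\<integral>\<^sup>+x. f (x + a) \<partial>lborel) = (\<integral>\<^sup>+x. f x \<partial>lborel)"
proof -
  have "(\<integral>\<^sup>+x. f x \<partial>lborel) = (\<integral>\<^sup>+x. f x \<partial>distr lborel borel ((+) a))"
    by (simp add: lborel_distr_plus)
  also have "\<dots> = (\<integral>\<^sup>+x. f (x + a) \<partial>lborel)"
    by (subst nn_integral_distr) (auto simp: add.commute)
  finally show ?thesis by simp
qed

lemma seg_avg_uminus:
  fixes z :: "'a::euclidean_space"
  assumes [measurable]: "f \<in> borel_measurable borel"
  shows "seg_avg (- z) f x = seg_avg z f x"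
  unfolding seg_avg_def
  by (subst nn_integral_real_affine[of _ "-1" 0])
     (auto intro!: nn_integral_cong simp: indicator_def)

text \<open>Translating by \<open>t *\<^sub>R z\<close> under the integral moves the average from
  \<open>g\<close> to \<open>f\<close> with \<open>- z\<close> in place of \<open>z\<close>, and the
  parameter interval is symmetric about 0.\<close>

lemma seg_avg_selfadjoint:
  fixes z :: "'a::euclidean_space"
  assumes [measurable]: "f \<in> borel_measurable borel" "g \<in> borel_measurable borel"
  shows "(\<integral>\<^sup>+x. f x * seg_avg z g x \<partial>lborel) = (\<integral>\<^sup>+x. seg_avg z f x * g x \<partial>lborel)"
proof -
  let ?I = "indicator {-1/2..1/2::real} :: real \<Rightarrow> ennreal"
  have "(\<integral>\<^sup>+x. f x * seg_avg z g x \<partial>lborel)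
      = (\<integral>\<^sup>+x. \<integral>\<^sup>+t. f x * (g (x + t *\<^sub>R z) * ?I t) \<partial>lborel \<partial>lborel)"
    unfolding seg_avg_def by (intro nn_integral_cong nn_integral_cmult[symmetric]) measurable
  also have "\<dots> = (\<integral>\<^sup>+t. \<integral>\<^sup>+x. f x * (g (x + t *\<^sub>R z) * ?I t) \<partial>lborel \<partial>lborel)"
    by (rule lborel_pair.Fubini') measurable
  also have "\<dots> = (\<integral>\<^sup>+t. \<integral>\<^sup>+x. f (x + t *\<^sub>R (- z)) * (g x * ?I t) \<partial>lborel \<partial>lborel)"
  proof (rule nn_integral_cong)
    fix t :: real
    show "(\<integral>\<^sup>+x. f x * (g (x + t *\<^sub>R z) * ?I t) \<partial>lborel)
        = (\<integral>\<^sup>+x. f (x + t *\<^sub>R (- z)) * (g x * ?I t) \<partial>lborel)"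
      using nn_integral_lborel_translate
        [of "\<lambda>x. f (x + t *\<^sub>R (- z)) * (g x * ?I t)" "t *\<^sub>R z"] by (simp add: add.assoc)
  qed
  also have "\<dots> = (\<integral>\<^sup>+x. \<integral>\<^sup>+t. f (x + t *\<^sub>R (- z)) * (g x * ?I t) \<partial>lborel \<partial>lborel)"
    by (intro lborel_pair.Fubini') measurable
  also have "\<dots> = (\<integral>\<^sup>+x. seg_avg (- z) f x * g x \<partial>lborel)"
    unfolding seg_avg_def
    by (subst nn_integral_multc[symmetric]) (auto simp: ac_simps)
  finally show ?thesis
    by (simp add: seg_avg_uminus)
qed

lemma seg_avg_const [simp]: "seg_avg z (\<lambda>_. c) x = c"
  unfolding seg_avg_def by (simp add: nn_integral_cmult)

lemma seg_avg_0 [simp]: "seg_avg 0 f = f"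
  unfolding seg_avg_def by (auto simp: nn_integral_cmult)

lemma seg_avg_sum:
  fixes z :: "'a::euclidean_space"
  assumes "\<And>i. i \<in> I \<Longrightarrow> f i \<in> borel_measurable borel"
  shows "seg_avg z (\<lambda>x. \<Sum>i\<in>I. f i x) x = (\<Sum>i\<in>I. seg_avg z (f i) x)"
  unfolding seg_avg_def using assms
  by (subst nn_integral_sum[symmetric]) (auto simp: sum_distrib_right intro: measurable_compose)

lemma seg_avg_power2_le:
  fixes z :: "'a::euclidean_space"
  assumes [measurable]: "f \<in> borel_measurable borel"
  shows "(seg_avg z f x)\<^sup>2 \<le> seg_avg z (\<lambda>x. (f x)\<^sup>2) x"
proof -
  let ?I = "indicator {-1/2..1/2::real} :: real \<Rightarrow> ennreal"
  have I: "(?I t)\<^sup>2 = ?I t" for t by (simp add: indicator_def)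
  have "(seg_avg z f x)\<^sup>2 = (\<integral>\<^sup>+t. (f (x + t *\<^sub>R z) * ?I t) * ?I t \<partial>lborel)\<^sup>2"
    unfolding seg_avg_def by (simp only: mult.assoc I[unfolded power2_eq_square])
  also have "\<dots> \<le> (\<integral>\<^sup>+t. (f (x + t *\<^sub>R z) * ?I t)\<^sup>2 \<partial>lborel) * (\<integral>\<^sup>+t. (?I t)\<^sup>2 \<partial>lborel)"
    by (intro Cauchy_Schwarz_nn_integral) measurable
  also have "\<dots> = seg_avg z (\<lambda>x. (f x)\<^sup>2) x"
    unfolding seg_avg_def by (simp only: power_mult_distrib I) simp
  finally show ?thesis .
qed

lemma nn_integral_seg_avg_power2_le:
  fixes z :: "'a::euclidean_space"
  assumes [measurable]: "f \<in> borel_measurable borel"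
  shows "(\<integral>\<^sup>+x. (seg_avg z f x)\<^sup>2 \<partial>lborel) \<le> (\<integral>\<^sup>+x. (f x)\<^sup>2 \<partial>lborel)"
proof -
  \<comment> \<open>The factor \<open>1\<close> prepares self-adjointness, which moves the average
    onto a constant function.\<close>
  have "(\<integral>\<^sup>+x. (seg_avg z f x)\<^sup>2 \<partial>lborel) \<le> (\<integral>\<^sup>+x. 1 * seg_avg z (\<lambda>x. (f x)\<^sup>2) x \<partial>lborel)"
    by (intro nn_integral_mono) (simp add: seg_avg_power2_le)
  also have "\<dots> = (\<integral>\<^sup>+x. (f x)\<^sup>2 \<partial>lborel)"
    by (subst seg_avg_selfadjoint) auto
  finally show ?thesis .
qed

text \<open>In the parameter along \<open>z\<close> the two averages have densities 1/c and 1/2 on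
  nested intervals, and 1/c \<le> 1 = 2 * (1/2).\<close>

lemma seg_avg_stretch:
  fixes z :: "'a::euclidean_space"
  assumes [measurable]: "f \<in> borel_measurable borel" and c: "1 \<le> c" "c \<le> 2"
  shows "seg_avg (c *\<^sub>R z) f x \<le> 2 * seg_avg (2 *\<^sub>R z) f x"
proof -
  let ?J = "(\<integral>\<^sup>+s. f (x + s *\<^sub>R z) * indicator {-1..1} s \<partial>lborel)"
  have I: "indicator {-(c/2)..c/2} (t * c) = (indicator {-(1/2)..1/2} t :: ennreal)" for t
  proof -
    have "t * c \<in> {-(c/2)..c/2} \<longleftrightarrow> c * (-1/2) \<le> c * t \<and> c * t \<le> c * (1/2)" by (auto simp: mult.commute)
    also have "\<dots> \<longleftrightarrow> t \<in> {-(1/2)..1/2}"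
      unfolding mult_le_cancel_left using c by auto
    finally show ?thesis by (simp add: indicator_def)
  qed
  have "seg_avg (c *\<^sub>R z) f x \<le> ennreal c * seg_avg (c *\<^sub>R z) f x"
    using c by (metis ennreal_1 ennreal_leI mult_1 mult_right_mono zero_le)
  also have "\<dots> = (\<integral>\<^sup>+s. f (x + s *\<^sub>R z) * indicator {-c/2..c/2} s \<partial>lborel)"
    unfolding seg_avg_def using c
    by (subst nn_integral_real_affine[of "\<lambda>s. f (x + s *\<^sub>R z) * indicator {-c/2..c/2} s" c 0])
       (use c in \<open>auto intro!: arg_cong[where f = "(*) (ennreal c)"] nn_integral_cong
          simp: I mult.commute\<close>)
  also have "\<dots> \<le> ?J"
    using c by (intro nn_integral_mono mult_left_mono) (auto simp: indicator_def)
  also have "?J = 2 * seg_avg (2 *\<^sub>R z) f x"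
    unfolding seg_avg_def using c
    by (subst nn_integral_real_affine[of _ 2 0])
       (auto intro!: arg_cong[where f = "(*) (2::ennreal)"] nn_integral_cong
          simp: indicator_def field_simps split: if_splits)
  finally show ?thesis .
qed

text \<open>The parallelogram spanned by \<open>v\<close> and \<open>w\<close> is contained in one spanned by \<open>2 v\<close> and \<open>z\<close>
  of twice its area.\<close>

lemma seg_avg_seg_avg_le:
  fixes v w z :: "'a::euclidean_space"
  assumes [measurable]: "f \<in> borel_measurable borel"
    and w: "w = \<mu> *\<^sub>R v + z" and \<mu>: "\<bar>\<mu>\<bar> \<le> 1"
  shows "seg_avg v (seg_avg w f) x \<le> 2 * seg_avg (2 *\<^sub>R v) (seg_avg z f) x"
proof -
  let ?I = "indicator {-1/2..1/2::real} :: real \<Rightarrow> ennreal"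
  let ?J = "indicator {-1..1::real} :: real \<Rightarrow> ennreal"
  have "seg_avg v (seg_avg w f) x
      = (\<integral>\<^sup>+s. \<integral>\<^sup>+t. f (x + s *\<^sub>R v + t *\<^sub>R w) * ?I t * ?I s \<partial>lborel \<partial>lborel)"
    unfolding seg_avg_def by (intro nn_integral_cong nn_integral_multc[symmetric]) measurable
  also have "\<dots> = (\<integral>\<^sup>+t. \<integral>\<^sup>+s. f (x + s *\<^sub>R v + t *\<^sub>R w) * ?I t * ?I s \<partial>lborel \<partial>lborel)"
    by (intro lborel_pair.Fubini') measurable
  also have "\<dots> \<le> (\<integral>\<^sup>+t. \<integral>\<^sup>+s. f (x + s *\<^sub>R v + t *\<^sub>R z) * ?I t * ?J s \<partial>lborel \<partial>lborel)"
  proof (rule nn_integral_mono)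
    fix t :: real
    \<comment> \<open>Substituting for \<open>w\<close> moves the parameter along \<open>v\<close>
      from \<open>s\<close> to \<open>s + t * \<mu>\<close>. Both summands are at most 1/2 in
      absolute value, which explains the interval \<open>{-1..1}\<close>; translation invariance
      then removes the shift.\<close>
    have "(\<integral>\<^sup>+s. f (x + s *\<^sub>R v + t *\<^sub>R w) * ?I t * ?I s \<partial>lborel)
        \<le> (\<integral>\<^sup>+s. f (x + (s + t * \<mu>) *\<^sub>R v + t *\<^sub>R z) * ?I t * ?J (s + t * \<mu>) \<partial>lborel)"
    proof (rule nn_integral_mono)
      fix s :: real
      have eq: "x + s *\<^sub>R v + t *\<^sub>R w = x + (s + t * \<mu>) *\<^sub>R v + t *\<^sub>R z"
        by (simp add: w algebra_simps)
      have "?I t * ?I s \<le> ?I t * ?J (s + t * \<mu>)"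
      proof (cases "\<bar>t\<bar> \<le> 1/2 \<and> \<bar>s\<bar> \<le> 1/2")
        case True
        have "\<bar>t * \<mu>\<bar> \<le> 1/2 * 1"
          unfolding abs_mult using True \<mu> by (intro mult_mono) auto
        with True show ?thesis by (auto simp: indicator_def)
      qed (auto simp: indicator_def)
      then show "f (x + s *\<^sub>R v + t *\<^sub>R w) * ?I t * ?I s
          \<le> f (x + (s + t * \<mu>) *\<^sub>R v + t *\<^sub>R z) * ?I t * ?J (s + t * \<mu>)"
        unfolding eq mult.assoc by (rule mult_left_mono) auto
    qed
    also have "\<dots> = (\<integral>\<^sup>+s. f (x + s *\<^sub>R v + t *\<^sub>R z) * ?I t * ?J s \<partial>lborel)"
      by (rule nn_integral_lborel_translate
        [of "\<lambda>s. f (x + s *\<^sub>R v + t *\<^sub>R z) * ?I t * ?J s" "t * \<mu>"]) measurable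
    finally show "(\<integral>\<^sup>+s. f (x + s *\<^sub>R v + t *\<^sub>R w) * ?I t * ?I s \<partial>lborel)
        \<le> (\<integral>\<^sup>+s. f (x + s *\<^sub>R v + t *\<^sub>R z) * ?I t * ?J s \<partial>lborel)" .
  qed
  also have "\<dots> = (\<integral>\<^sup>+s. \<integral>\<^sup>+t. f (x + s *\<^sub>R v + t *\<^sub>R z) * ?I t * ?J s \<partial>lborel \<partial>lborel)"
    by (intro lborel_pair.Fubini') measurable
  also have "\<dots> = (\<integral>\<^sup>+s. seg_avg z f (x + s *\<^sub>R v) * ?J s \<partial>lborel)"
    unfolding seg_avg_def by (intro nn_integral_cong nn_integral_multc) measurable
  also have "\<dots> = 2 * seg_avg (2 *\<^sub>R v) (seg_avg z f) x"
    unfolding seg_avg_def[of "2 *\<^sub>R v"]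
    by (subst nn_integral_real_affine[of _ 2 0])
       (auto intro!: arg_cong[where f = "(*) (2::ennreal)"] nn_integral_cong
          simp: indicator_def field_simps split: if_splits)
  finally show ?thesis .
qed

section \<open>The dual inequality for a family of segments\<close>

lemma sum_power2_le_power2_sum:
  fixes f :: "'i \<Rightarrow> ennreal"
  assumes "finite I"
  shows "(\<Sum>i\<in>I. (f i)\<^sup>2) \<le> (\<Sum>i\<in>I. f i)\<^sup>2"
proof -
  have "(\<Sum>i\<in>I. (f i)\<^sup>2) \<le> (\<Sum>i\<in>I. f i * (\<Sum>j\<in>I. f j))"
    unfolding power2_eq_square using assms
    by (intro sum_mono mult_left_mono member_le_sum) auto
  then show ?thesis
    by (simp add: power2_eq_square sum_distrib_right)
qed

lemma power2_sum_le_card_mult: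
  fixes f :: "'i \<Rightarrow> ennreal"
  assumes "finite I"
  shows "(\<Sum>i\<in>I. f i)\<^sup>2 \<le> of_nat (card I) * (\<Sum>i\<in>I. (f i)\<^sup>2)"
  using Cauchy_Schwarz_nn_integral[of "\<lambda>_. 1" "count_space I" f] assms
  by (simp add: nn_integral_count_space_finite)

lemma nn_integral_mult_le:
  assumes [measurable]: "f \<in> borel_measurable M" "g \<in> borel_measurable M"
    and f: "(\<integral>\<^sup>+x. (f x)\<^sup>2 \<partial>M) \<le> ennreal (a\<^sup>2) * G"
    and g: "(\<integral>\<^sup>+x. (g x)\<^sup>2 \<partial>M) \<le> ennreal (b\<^sup>2) * G"
    and ab: "0 \<le> a" "0 \<le> b"
  shows "(\<integral>\<^sup>+x. f x * g x \<partial>M) \<le> ennreal (a * b) * G"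
proof (rule ennreal_le_of_power2_le)
  have "(\<integral>\<^sup>+x. f x * g x \<partial>M)\<^sup>2 \<le> (\<integral>\<^sup>+x. (f x)\<^sup>2 \<partial>M) * (\<integral>\<^sup>+x. (g x)\<^sup>2 \<partial>M)"
    by (rule Cauchy_Schwarz_nn_integral) measurable
  also have "\<dots> \<le> (ennreal (a\<^sup>2) * G) * (ennreal (b\<^sup>2) * G)"
    by (intro mult_mono f g) auto
  also have "\<dots> = (ennreal (a * b) * G)\<^sup>2"
    using ab by (simp add: power2_eq_square ennreal_mult ac_simps)
  finally show "(\<integral>\<^sup>+x. f x * g x \<partial>M)\<^sup>2 \<le> (ennreal (a * b) * G)\<^sup>2" .
qed

lemma nn_integral_sum_mult_sum:
  assumes "\<And>i. i \<in> I \<Longrightarrow> f i \<in> borel_measurable M"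
    and "\<And>j. j \<in> J \<Longrightarrow> g j \<in> borel_measurable M"
  shows "(\<integral>\<^sup>+x. (\<Sum>i\<in>I. f i x) * (\<Sum>j\<in>J. g j x) \<partial>M)
    = (\<Sum>i\<in>I. \<Sum>j\<in>J. \<integral>\<^sup>+x. f i x * g j x \<partial>M)"
proof -
  have "(\<integral>\<^sup>+x. (\<Sum>i\<in>I. f i x) * (\<Sum>j\<in>J. g j x) \<partial>M)
      = (\<integral>\<^sup>+x. (\<Sum>i\<in>I. \<Sum>j\<in>J. f i x * g j x) \<partial>M)"
    by (simp only: sum_product)
  also have "\<dots> = (\<Sum>i\<in>I. \<integral>\<^sup>+x. (\<Sum>j\<in>J. f i x * g j x) \<partial>M)"
    using assms by (intro nn_integral_sum borel_measurable_sum borel_measurable_times) auto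
  also have "\<dots> = (\<Sum>i\<in>I. \<Sum>j\<in>J. \<integral>\<^sup>+x. f i x * g j x \<partial>M)"
    using assms by (intro sum.cong nn_integral_sum borel_measurable_times) auto
  finally show ?thesis .
qed

text \<open>The \<open>g i\<close> play the role of a function cut into disjoint pieces; disjointness of their supports
  is not required, because only their sum enters the right-hand side.\<close>

definition adj_bound :: "'i set \<Rightarrow> ('i \<Rightarrow> 'a::euclidean_space) \<Rightarrow> real \<Rightarrow> bool" where
  "adj_bound I z K \<longleftrightarrow> (\<forall>g. (\<forall>i\<in>I. g i \<in> borel_measurable borel) \<longrightarrow>
     (\<integral>\<^sup>+x. (\<Sum>i\<in>I. seg_avg (z i) (g i) x)\<^sup>2 \<partial>lborel)
       \<le> ennreal (K\<^sup>2) * (\<integral>\<^sup>+x. (\<Sum>i\<in>I. g i x)\<^sup>2 \<partial>lborel))"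

lemma adj_boundI:
  assumes "\<And>g. (\<And>i. i \<in> I \<Longrightarrow> g i \<in> borel_measurable borel) \<Longrightarrow>
     (\<integral>\<^sup>+x. (\<Sum>i\<in>I. seg_avg (z i) (g i) x)\<^sup>2 \<partial>lborel)
       \<le> ennreal (K\<^sup>2) * (\<integral>\<^sup>+x. (\<Sum>i\<in>I. g i x)\<^sup>2 \<partial>lborel)"
  shows "adj_bound I z K"
  using assms unfolding adj_bound_def by blast

lemma adj_boundD:
  assumes "adj_bound I z K" "\<And>i. i \<in> I \<Longrightarrow> g i \<in> borel_measurable borel"
  shows "(\<integral>\<^sup>+x. (\<Sum>i\<in>I. seg_avg (z i) (g i) x)\<^sup>2 \<partial>lborel)
       \<le> ennreal (K\<^sup>2) * (\<integral>\<^sup>+x. (\<Sum>i\<in>I. g i x)\<^sup>2 \<partial>lborel)"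
  using assms unfolding adj_bound_def by blast

lemma adj_boundD_subset:
  assumes "adj_bound J z K" "J \<subseteq> I" "finite I" "\<And>i. i \<in> I \<Longrightarrow> g i \<in> borel_measurable borel"
  shows "(\<integral>\<^sup>+x. (\<Sum>i\<in>J. seg_avg (z i) (g i) x)\<^sup>2 \<partial>lborel)
       \<le> ennreal (K\<^sup>2) * (\<integral>\<^sup>+x. (\<Sum>i\<in>I. g i x)\<^sup>2 \<partial>lborel)"
proof -
  have "(\<integral>\<^sup>+x. (\<Sum>i\<in>J. seg_avg (z i) (g i) x)\<^sup>2 \<partial>lborel)
      \<le> ennreal (K\<^sup>2) * (\<integral>\<^sup>+x. (\<Sum>i\<in>J. g i x)\<^sup>2 \<partial>lborel)"
    using assms by (intro adj_boundD) auto
  also have "\<dots> \<le> ennreal (K\<^sup>2) * (\<integral>\<^sup>+x. (\<Sum>i\<in>I. g i x)\<^sup>2 \<partial>lborel)"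
    using assms by (intro mult_left_mono nn_integral_mono power_mono_ennreal sum_mono2) auto
  finally show ?thesis .
qed

lemma adj_bound_mono:
  fixes z :: "'i \<Rightarrow> 'a::euclidean_space"
  assumes "adj_bound I z K" "0 \<le> K" "K \<le> K'"
  shows "adj_bound I z K'"
proof (rule adj_boundI)
  fix g :: "'i \<Rightarrow> 'a \<Rightarrow> ennreal" assume g: "\<And>i. i \<in> I \<Longrightarrow> g i \<in> borel_measurable borel"
  show "(\<integral>\<^sup>+x. (\<Sum>i\<in>I. seg_avg (z i) (g i) x)\<^sup>2 \<partial>lborel)
      \<le> ennreal (K'\<^sup>2) * (\<integral>\<^sup>+x. (\<Sum>i\<in>I. g i x)\<^sup>2 \<partial>lborel)"
    using assms(2,3)
    by (intro order_trans[OF adj_boundD[OF assms(1)]] mult_right_mono ennreal_leI power_mono)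
       (auto intro: g)
qed

lemma adj_bound_cong:
  "(\<And>i. i \<in> I \<Longrightarrow> z i = z' i) \<Longrightarrow> adj_bound I z K \<longleftrightarrow> adj_bound I z' K"
  unfolding adj_bound_def by (simp cong: sum.cong)

text \<open>Cauchy-Schwarz over the index set costs the factor \<open>card I\<close>, each average
  is a contraction, and nonnegativity bounds the sum of squares by the square of the sum. This
  starts both the iteration for parallel segments and the induction for coplanar ones.\<close>

lemma adj_bound_sqrt_card:
  fixes z :: "'i \<Rightarrow> 'a::euclidean_space"
  assumes "finite I"
  shows "adj_bound I z (sqrt (card I))"
proof (rule adj_boundI)
  fix g :: "'i \<Rightarrow> 'a \<Rightarrow> ennreal" assume g [measurable]: "\<And>i. i \<in> I \<Longrightarrow> g i \<in> borel_measurable borel"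
  have "(\<integral>\<^sup>+x. (\<Sum>i\<in>I. seg_avg (z i) (g i) x)\<^sup>2 \<partial>lborel)
      \<le> (\<integral>\<^sup>+x. of_nat (card I) * (\<Sum>i\<in>I. (seg_avg (z i) (g i) x)\<^sup>2) \<partial>lborel)"
    using assms by (intro nn_integral_mono power2_sum_le_card_mult)
  also have "\<dots> = of_nat (card I) * (\<Sum>i\<in>I. \<integral>\<^sup>+x. (seg_avg (z i) (g i) x)\<^sup>2 \<partial>lborel)"
    by (subst nn_integral_cmult) (auto intro!: nn_integral_sum arg_cong[where f = "(*) _"])
  also have "\<dots> \<le> of_nat (card I) * (\<Sum>i\<in>I. \<integral>\<^sup>+x. (g i x)\<^sup>2 \<partial>lborel)"
    by (intro mult_left_mono sum_mono nn_integral_seg_avg_power2_le) auto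
  also have "(\<Sum>i\<in>I. \<integral>\<^sup>+x. (g i x)\<^sup>2 \<partial>lborel) = (\<integral>\<^sup>+x. (\<Sum>i\<in>I. (g i x)\<^sup>2) \<partial>lborel)"
    by (intro nn_integral_sum[symmetric]) auto
  also have "of_nat (card I) * \<dots> \<le> of_nat (card I) * (\<integral>\<^sup>+x. (\<Sum>i\<in>I. g i x)\<^sup>2 \<partial>lborel)"
    using assms by (intro mult_left_mono nn_integral_mono sum_power2_le_power2_sum) auto
  finally show "(\<integral>\<^sup>+x. (\<Sum>i\<in>I. seg_avg (z i) (g i) x)\<^sup>2 \<partial>lborel)
      \<le> ennreal ((sqrt (card I))\<^sup>2) * (\<integral>\<^sup>+x. (\<Sum>i\<in>I. g i x)\<^sup>2 \<partial>lborel)"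
    by (simp add: ennreal_of_nat_eq_real_of_nat)
qed

text \<open>Self-adjointness turns the pairing into a composition of averages, where parallelograms
  can be compared, and then back. Because \<open>v\<close> gets doubled, later arguments assume
  their bounds for all lengths at once.\<close>

lemma nn_integral_seg_avg_pair_le:
  fixes v w z :: "'a::euclidean_space"
  assumes [measurable]: "f \<in> borel_measurable borel" "g \<in> borel_measurable borel"
    and "w = \<mu> *\<^sub>R v + z" "\<bar>\<mu>\<bar> \<le> 1"
  shows "(\<integral>\<^sup>+x. seg_avg v f x * seg_avg w g x \<partial>lborel)
    \<le> 2 * (\<integral>\<^sup>+x. seg_avg (2 *\<^sub>R v) f x * seg_avg z g x \<partial>lborel)"
proof -
  have "(\<integral>\<^sup>+x. seg_avg v f x * seg_avg w g x \<partial>lborel)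
      = (\<integral>\<^sup>+x. f x * seg_avg v (seg_avg w g) x \<partial>lborel)"
    by (rule seg_avg_selfadjoint[symmetric]) measurable
  also have "\<dots> \<le> (\<integral>\<^sup>+x. f x * (2 * seg_avg (2 *\<^sub>R v) (seg_avg z g) x) \<partial>lborel)"
    using assms by (intro nn_integral_mono mult_left_mono seg_avg_seg_avg_le) auto
  also have "\<dots> = 2 * (\<integral>\<^sup>+x. f x * seg_avg (2 *\<^sub>R v) (seg_avg z g) x \<partial>lborel)"
    by (subst nn_integral_cmult[symmetric]) (auto simp: ac_simps)
  also have "(\<integral>\<^sup>+x. f x * seg_avg (2 *\<^sub>R v) (seg_avg z g) x \<partial>lborel)
      = (\<integral>\<^sup>+x. seg_avg (2 *\<^sub>R v) f x * seg_avg z g x \<partial>lborel)"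
    by (rule seg_avg_selfadjoint) measurable
  finally show ?thesis .
qed

section \<open>Parallel segments of different lengths\<close>

text \<open>In every product of two averages, the longer one, stretched twofold, absorbs the
  shorter. The square is thus at most four times the pairing of the stretched family with the sum of
  the \<open>g i\<close>, and Cauchy-Schwarz uses the assumed bound only once: \<open>4 * K\<close>
  replaces the square of \<open>K\<close>.\<close>

lemma adj_bound_parallel_improve:
  fixes u :: "'a::euclidean_space" and I :: "'i set"
  assumes K: "0 \<le> K"
    and bound: "\<And>r. adj_bound I (\<lambda>i. r i *\<^sub>R u) K"
  shows "adj_bound I (\<lambda>i. r i *\<^sub>R u) (sqrt (4 * K))"
proof (rule adj_boundI)
  fix g :: "'i \<Rightarrow> 'a \<Rightarrow> ennreal" assume g [measurable]: "\<And>i. i \<in> I \<Longrightarrow> g i \<in> borel_measurable borel"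
  define A where "A i = seg_avg (r i *\<^sub>R u) (g i)" for i
  define B where "B i = seg_avg ((2 * r i) *\<^sub>R u) (g i)" for i
  have A [measurable]: "A i \<in> borel_measurable borel" if "i \<in> I" for i
    unfolding A_def using that by measurable
  have B [measurable]: "B i \<in> borel_measurable borel" if "i \<in> I" for i
    unfolding B_def using that by measurable
  let ?G = "\<integral>\<^sup>+x. (\<Sum>i\<in>I. g i x)\<^sup>2 \<partial>lborel"
  have shorter: "(\<integral>\<^sup>+x. A i x * A j x \<partial>lborel) \<le> 2 * (\<integral>\<^sup>+x. B i x * g j x \<partial>lborel)"
    if "i \<in> I" "j \<in> I" "\<bar>r j\<bar> \<le> \<bar>r i\<bar>" for i j
  proof -
    \<comment> \<open>The remainder is \<open>0\<close>, so the second average becomes the identity.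
      If \<open>r i = 0\<close>, then \<open>r j = 0\<close> as well, and the quotient has the
      default value 0.\<close>
    have eq: "r j *\<^sub>R u = (r j / r i) *\<^sub>R (r i *\<^sub>R u) + 0"
      using that by (cases "r i = 0") auto
    show ?thesis
      using nn_integral_seg_avg_pair_le[OF g[OF that(1)] g[OF that(2)] eq] that(3)
      by (cases "r i = 0") (auto simp: A_def B_def)
  qed
  \<comment> \<open>Adding both alternatives removes the dependence on which segment is longer, so
    that the double sum factors.\<close>
  have pair: "(\<integral>\<^sup>+x. A i x * A j x \<partial>lborel)
      \<le> 2 * (\<integral>\<^sup>+x. B i x * g j x \<partial>lborel) + 2 * (\<integral>\<^sup>+x. g i x * B j x \<partial>lborel)"
    if "i \<in> I" "j \<in> I" for i j
    using shorter[OF that] shorter[OF that(2,1)]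
    by (cases "\<bar>r j\<bar> \<le> \<bar>r i\<bar>") (auto simp: mult.commute intro: add_increasing add_increasing2)
  have "(\<integral>\<^sup>+x. (\<Sum>i\<in>I. A i x)\<^sup>2 \<partial>lborel) = (\<Sum>i\<in>I. \<Sum>j\<in>I. \<integral>\<^sup>+x. A i x * A j x \<partial>lborel)"
    unfolding power2_eq_square using A by (intro nn_integral_sum_mult_sum) auto
  also have "\<dots> \<le> (\<Sum>i\<in>I. \<Sum>j\<in>I. 2 * (\<integral>\<^sup>+x. B i x * g j x \<partial>lborel)
      + 2 * (\<integral>\<^sup>+x. g i x * B j x \<partial>lborel))"
    by (intro sum_mono pair)
  also have "\<dots> = 2 * (\<Sum>i\<in>I. \<Sum>j\<in>I. \<integral>\<^sup>+x. B i x * g j x \<partial>lborel)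
      + 2 * (\<Sum>i\<in>I. \<Sum>j\<in>I. \<integral>\<^sup>+x. g i x * B j x \<partial>lborel)"
    by (simp only: sum.distrib sum_distrib_left)
  also have "\<dots> = 2 * (\<integral>\<^sup>+x. (\<Sum>i\<in>I. B i x) * (\<Sum>i\<in>I. g i x) \<partial>lborel)
      + 2 * (\<integral>\<^sup>+x. (\<Sum>i\<in>I. g i x) * (\<Sum>i\<in>I. B i x) \<partial>lborel)"
    by (intro arg_cong2[where f = "(+)"] arg_cong[where f = "(*) 2"]
      nn_integral_sum_mult_sum[symmetric]) (auto intro: B g)
  also have "\<dots> = 4 * (\<integral>\<^sup>+x. (\<Sum>i\<in>I. B i x) * (\<Sum>i\<in>I. g i x) \<partial>lborel)"
    by (simp add: mult.commute flip: distrib_right)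
  also have "\<dots> \<le> 4 * (ennreal (K * 1) * ?G)"
  proof (intro mult_left_mono nn_integral_mult_le)
    show "(\<integral>\<^sup>+x. (\<Sum>i\<in>I. B i x)\<^sup>2 \<partial>lborel) \<le> ennreal (K\<^sup>2) * ?G"
      unfolding B_def by (intro adj_boundD bound g)
  qed (use K B g in auto)
  also have "\<dots> = ennreal ((sqrt (4 * K))\<^sup>2) * ?G"
    using K by (simp add: ennreal_mult mult.assoc)
  finally show "(\<integral>\<^sup>+x. (\<Sum>i\<in>I. seg_avg (r i *\<^sub>R u) (g i) x)\<^sup>2 \<partial>lborel)
      \<le> ennreal ((sqrt (4 * K))\<^sup>2) * ?G"
    unfolding A_def .
qed

text \<open>A Hardy--Littlewood type inequality, obtained by iterating \<open>K \<mapsto> sqrt (4 * K)\<close>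
  towards its fixed point, from the trivial bound.\<close>

lemma adj_bound_parallel:
  fixes u :: "'a::euclidean_space" and I :: "'i set"
  assumes fin: "finite I"
  shows "adj_bound I (\<lambda>i. r i *\<^sub>R u) 4"
proof (rule adj_boundI)
  fix g :: "'i \<Rightarrow> 'a \<Rightarrow> ennreal" assume g [measurable]: "\<And>i. i \<in> I \<Longrightarrow> g i \<in> borel_measurable borel"
  \<comment> \<open>\<open>4 * c\<close> dominates the trivial bound, and \<open>K n\<close> is the
    n-th iterate started there: its distance from the fixed point 4 sits in the exponent of
    \<open>c\<close>, which is halved each time.\<close>
  define c where "c = max 1 (sqrt (card I) / 4)"
  define K where "K n = 4 * c powr ((1/2) ^ n)" for n :: nat
  have c: "c \<ge> 1" unfolding c_def by simp
  have K_pos: "K n > 0" for n unfolding K_def using c by simp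
  have K: "adj_bound I (\<lambda>i. r i *\<^sub>R u) (K n)" for r n
  proof (induction n arbitrary: r)
    case 0
    show ?case
      by (rule adj_bound_mono[OF adj_bound_sqrt_card[OF fin]]) (auto simp: K_def c_def)
  next
    case (Suc n)
    have "sqrt (4 * K n) = 4 * sqrt (c powr ((1/2) ^ n))"
      unfolding K_def by (simp add: real_sqrt_mult)
    also have "\<dots> = K (Suc n)"
      unfolding K_def using c by (simp add: powr_half_sqrt[symmetric] powr_powr)
    finally show ?case
      using adj_bound_parallel_improve[OF less_imp_le[OF K_pos] Suc] by metis
  qed
  let ?S = "\<integral>\<^sup>+x. (\<Sum>i\<in>I. seg_avg (r i *\<^sub>R u) (g i) x)\<^sup>2 \<partial>lborel"
  let ?G = "\<integral>\<^sup>+x. (\<Sum>i\<in>I. g i x)\<^sup>2 \<partial>lborel"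
  show "?S \<le> ennreal (4\<^sup>2) * ?G"
  proof (cases "?G = top")
    case True
    then show ?thesis by (simp add: ennreal_mult_top)
  next
    case False
    have "(\<lambda>n. K n) \<longlonglongrightarrow> 4 * c powr 0"
      unfolding K_def using c by (intro tendsto_intros LIMSEQ_power_zero) auto
    then have "(\<lambda>n. (K n)\<^sup>2) \<longlonglongrightarrow> 4\<^sup>2"
      using c by (intro tendsto_power) auto
    then have "(\<lambda>n. ennreal ((K n)\<^sup>2) * ?G) \<longlonglongrightarrow> ennreal (4\<^sup>2) * ?G"
      unfolding mult.commute[of _ ?G] using False
      by (intro ennreal_tendsto_cmult tendsto_ennrealI) (auto simp: less_top)
    then show ?thesis
      by (rule LIMSEQ_le_const) (use adj_boundD[OF K g] in auto)
  qed
qed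

section \<open>Coplanar segments\<close>

text \<open>If \<open>|q| \<le> |p|\<close>, the shorter vector \<open>w\<close> is a multiple of \<open>v\<close> by a factor in \<open>[-1, 1]\<close> plus a vector
  of length comparable to that of \<open>q u\<close> (if \<open>b \<le> a\<close>) or \<open>q b V\<close> (if \<open>a \<le> b\<close>). The right-hand side
  decouples: its second factor depends on \<open>w\<close> only.\<close>

lemma nn_integral_seg_avg_cross_le:
  fixes u V :: "'a::euclidean_space"
  assumes [measurable]: "f \<in> borel_measurable borel" "g \<in> borel_measurable borel"
    and "0 \<le> a" "0 \<le> b" and len: "\<bar>q\<bar> \<le> \<bar>p\<bar>"
  defines "v \<equiv> p *\<^sub>R (u - a *\<^sub>R V)" and "w \<equiv> q *\<^sub>R (u + b *\<^sub>R V)"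
  shows "(\<integral>\<^sup>+x. seg_avg v f x * seg_avg w g x \<partial>lborel)
    \<le> 4 * (\<integral>\<^sup>+x. seg_avg (2 *\<^sub>R v) f x *
        (seg_avg ((2 * q) *\<^sub>R u) g x + seg_avg ((2 * (q * b)) *\<^sub>R V) g x) \<partial>lborel)"
    (is "?lhs \<le> 4 * (\<integral>\<^sup>+x. ?f x * (?g1 x + ?g2 x) \<partial>lborel)")
proof -
  \<comment> \<open>The factor \<open>c\<close> will depend on both segments; stretching it to 2
    leaves a vector \<open>z\<close> that depends on \<open>w\<close> only.\<close>
  have shear: "?lhs \<le> 4 * (\<integral>\<^sup>+x. ?f x * seg_avg (2 *\<^sub>R z) g x \<partial>lborel)"
    if w_eq: "w = \<mu> *\<^sub>R v + c *\<^sub>R z" and \<mu>: "\<bar>\<mu>\<bar> \<le> 1" and c: "1 \<le> c" "c \<le> 2" for \<mu> c z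
  proof -
    have "?lhs \<le> 2 * (\<integral>\<^sup>+x. ?f x * seg_avg (c *\<^sub>R z) g x \<partial>lborel)"
      by (rule nn_integral_seg_avg_pair_le[OF _ _ w_eq \<mu>]) measurable
    also have "\<dots> \<le> 2 * (\<integral>\<^sup>+x. ?f x * (2 * seg_avg (2 *\<^sub>R z) g x) \<partial>lborel)"
      using c by (intro mult_left_mono nn_integral_mono seg_avg_stretch) auto
    also have "\<dots> = 4 * (\<integral>\<^sup>+x. ?f x * seg_avg (2 *\<^sub>R z) g x \<partial>lborel)"
    proof -
      have "(\<integral>\<^sup>+x. ?f x * (2 * seg_avg (2 *\<^sub>R z) g x) \<partial>lborel)
          = 2 * (\<integral>\<^sup>+x. ?f x * seg_avg (2 *\<^sub>R z) g x \<partial>lborel)"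
        by (subst nn_integral_cmult[symmetric]) (auto simp: ac_simps)
      then show ?thesis by (simp add: mult.assoc[symmetric])
    qed
    finally show ?thesis .
  qed
  have "?lhs \<le> 4 * (\<integral>\<^sup>+x. ?f x * ?g1 x \<partial>lborel) \<or> ?lhs \<le> 4 * (\<integral>\<^sup>+x. ?f x * ?g2 x \<partial>lborel)"
  proof (cases "b \<le> a")
    case True
    \<comment> \<open>With this ratio the \<open>V\<close> components of \<open>w\<close> and of the
      multiple of \<open>v\<close> agree, leaving a multiple of \<open>u\<close>. If
      \<open>a = 0\<close>, then \<open>b = 0\<close> and the default quotient 0 is right; likewise
      \<open>p = 0\<close> forces \<open>q = 0\<close>.\<close>
    define \<kappa> where "\<kappa> = b / a"
    have \<kappa>: "0 \<le> \<kappa>" "\<kappa> \<le> 1" "\<kappa> * a = b"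
      using True assms by (auto simp: \<kappa>_def divide_le_eq_1)
    have w_eq: "w = (- (q / p) * \<kappa>) *\<^sub>R v + (1 + \<kappa>) *\<^sub>R (q *\<^sub>R u)"
      using len \<kappa>(3)[symmetric] unfolding v_def w_def
      by (cases "p = 0") (auto simp: algebra_simps)
    have \<mu>: "\<bar>- (q / p) * \<kappa>\<bar> \<le> 1"
    proof -
      have "\<bar>q / p\<bar> \<le> 1" using len by (cases "p = 0") auto
      then show ?thesis
        unfolding abs_mult abs_minus_cancel using \<kappa> by (intro mult_le_one) auto
    qed
    have "?lhs \<le> 4 * (\<integral>\<^sup>+x. ?f x * seg_avg (2 *\<^sub>R (q *\<^sub>R u)) g x \<partial>lborel)"
      using \<kappa> by (intro shear[OF w_eq \<mu>]) auto
    then show ?thesis by simp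
  next
    case False
    \<comment> \<open>Here the \<open>u\<close> components agree instead, and a multiple of
      \<open>V\<close> is left.\<close>
    define \<kappa> where "\<kappa> = a / b"
    have \<kappa>: "0 \<le> \<kappa>" "\<kappa> \<le> 1" "\<kappa> * b = a"
      using False assms by (auto simp: \<kappa>_def divide_le_eq_1)
    have w_eq: "w = (q / p) *\<^sub>R v + (1 + \<kappa>) *\<^sub>R ((q * b) *\<^sub>R V)"
      using len \<kappa>(3)[symmetric] unfolding v_def w_def
      by (cases "p = 0") (auto simp: algebra_simps)
    have \<mu>: "\<bar>q / p\<bar> \<le> 1"
      using len by (cases "p = 0") auto
    have "?lhs \<le> 4 * (\<integral>\<^sup>+x. ?f x * seg_avg (2 *\<^sub>R ((q * b) *\<^sub>R V)) g x \<partial>lborel)"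
      using \<kappa> by (intro shear[OF w_eq \<mu>]) auto
    then show ?thesis by simp
  qed
  moreover have "(\<integral>\<^sup>+x. ?f x * ?g1 x \<partial>lborel) \<le> (\<integral>\<^sup>+x. ?f x * (?g1 x + ?g2 x) \<partial>lborel)"
    "(\<integral>\<^sup>+x. ?f x * ?g2 x \<partial>lborel) \<le> (\<integral>\<^sup>+x. ?f x * (?g1 x + ?g2 x) \<partial>lborel)"
    by (auto intro!: nn_integral_mono mult_left_mono)
  ultimately show ?thesis
    by (meson mult_left_mono order_trans zero_le)
qed

lemma nn_integral_power2_add:
  assumes [measurable]: "f \<in> borel_measurable M" "g \<in> borel_measurable M"
  shows "(\<integral>\<^sup>+x. (f x + g x)\<^sup>2 \<partial>M)
    = (\<integral>\<^sup>+x. (f x)\<^sup>2 \<partial>M) + (\<integral>\<^sup>+x. (g x)\<^sup>2 \<partial>M) + 2 * (\<integral>\<^sup>+x. f x * g x \<partial>M)"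
  by (simp add: power2_sum mult.assoc nn_integral_add nn_integral_cmult)

text \<open>The triangle inequality in squared form: each part alone is bounded in terms of the sum
  of all \<open>g i\<close>, and Cauchy-Schwarz handles the cross term.\<close>

lemma adj_bound_Un:
  fixes z :: "'i \<Rightarrow> 'a::euclidean_space"
  assumes fin: "finite I" "finite J" and disj: "I \<inter> J = {}"
    and I: "adj_bound I z K" and J: "adj_bound J z K'" and K: "0 \<le> K" "0 \<le> K'"
  shows "adj_bound (I \<union> J) z (K + K')"
proof (rule adj_boundI)
  fix g :: "'i \<Rightarrow> 'a \<Rightarrow> ennreal"
  assume g: "\<And>i. i \<in> I \<union> J \<Longrightarrow> g i \<in> borel_measurable borel"
  define S where "S L x = (\<Sum>i\<in>L. seg_avg (z i) (g i) x)" for L x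
  have [measurable]: "S I \<in> borel_measurable borel" "S J \<in> borel_measurable borel"
    unfolding S_def[abs_def] by (auto intro!: borel_measurable_sum borel_measurable_seg_avg g)
  let ?G = "\<integral>\<^sup>+x. (\<Sum>i\<in>I \<union> J. g i x)\<^sup>2 \<partial>lborel"
  have SI: "(\<integral>\<^sup>+x. (S I x)\<^sup>2 \<partial>lborel) \<le> ennreal (K\<^sup>2) * ?G"
    and SJ: "(\<integral>\<^sup>+x. (S J x)\<^sup>2 \<partial>lborel) \<le> ennreal (K'\<^sup>2) * ?G"
    unfolding S_def using fin g I J by (auto intro!: adj_boundD_subset)
  have "(\<integral>\<^sup>+x. (S (I \<union> J) x)\<^sup>2 \<partial>lborel) = (\<integral>\<^sup>+x. (S I x + S J x)\<^sup>2 \<partial>lborel)"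
    unfolding S_def using fin disj by (simp add: sum.union_disjoint)
  also have "\<dots> = (\<integral>\<^sup>+x. (S I x)\<^sup>2 \<partial>lborel) + (\<integral>\<^sup>+x. (S J x)\<^sup>2 \<partial>lborel)
      + 2 * (\<integral>\<^sup>+x. S I x * S J x \<partial>lborel)"
    by (rule nn_integral_power2_add) measurable
  also have "\<dots> \<le> ennreal (K\<^sup>2) * ?G + ennreal (K'\<^sup>2) * ?G + 2 * (ennreal (K * K') * ?G)"
    by (intro add_mono mult_left_mono SI SJ nn_integral_mult_le K) auto
  also have "\<dots> = (ennreal (K\<^sup>2) + ennreal (K'\<^sup>2) + ennreal 2 * ennreal (K * K')) * ?G"
    by (simp add: distrib_right mult.assoc)
  also have "ennreal (K\<^sup>2) + ennreal (K'\<^sup>2) + ennreal 2 * ennreal (K * K') = ennreal ((K + K')\<^sup>2)"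
  proof -
    have "ennreal 2 * ennreal (K * K') = ennreal (2 * (K * K'))"
      using K by (intro ennreal_mult[symmetric]) auto
    then show ?thesis
      using K by (simp only: power2_sum mult.assoc) (simp flip: ennreal_plus)
  qed
  finally show "(\<integral>\<^sup>+x. (\<Sum>i\<in>I \<union> J. seg_avg (z i) (g i) x)\<^sup>2 \<partial>lborel)
      \<le> ennreal ((K + K')\<^sup>2) * ?G"
    unfolding S_def .
qed

section \<open>Splitting at a median slope\<close>

text \<open>Ties in \<open>m\<close> rule out cutting at a value, so minimisers among the remaining
  elements are added one at a time.\<close>

lemma obtain_lower_subset:
  fixes m :: "'i \<Rightarrow> 'b::linorder"
  assumes "finite I" "n \<le> card I"
  obtains L where "L \<subseteq> I" "card L = n" "\<And>i j. i \<in> L \<Longrightarrow> j \<in> I - L \<Longrightarrow> m i \<le> m j"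
proof -
  have "\<exists>L\<subseteq>I. card L = n \<and> (\<forall>i\<in>L. \<forall>j\<in>I - L. m i \<le> m j)"
    using assms(2)
  proof (induction n)
    case 0
    show ?case by (intro exI[of _ "{}"]) auto
  next
    case (Suc n)
    then obtain L where L: "L \<subseteq> I" "card L = n" "\<forall>i\<in>L. \<forall>j\<in>I - L. m i \<le> m j"
      by auto
    have fin: "finite (I - L)" "finite L" and ne: "I - L \<noteq> {}"
      using assms(1) L Suc.prems by (auto dest: finite_subset card_mono)
    define k where "k = arg_min_on m (I - L)"
    have k: "k \<in> I - L" "\<And>j. j \<in> I - L \<Longrightarrow> m k \<le> m j"
      unfolding k_def using arg_min_if_finite(1)[OF fin(1) ne, of m]
      by (simp_all add: arg_min_least[OF fin(1) ne])
    show ?case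
      using L k fin by (intro exI[of _ "insert k L"]) auto
  qed
  then show thesis using that by blast
qed

lemma obtain_threshold_split:
  fixes m :: "'i \<Rightarrow> real"
  assumes "finite I" "card I \<le> 2 * n"
  obtains L R c where "L \<inter> R = {}" "I = L \<union> R" "card L \<le> n" "card R \<le> n"
    "\<And>i. i \<in> L \<Longrightarrow> m i \<le> c" "\<And>j. j \<in> R \<Longrightarrow> c \<le> m j"
proof -
  obtain L where L: "L \<subseteq> I" "card L = card I div 2" "\<And>i j. i \<in> L \<Longrightarrow> j \<in> I - L \<Longrightarrow> m i \<le> m j"
    using obtain_lower_subset[OF assms(1), of "card I div 2" m] by auto
  have fin: "finite L" using L(1) assms(1) finite_subset by blast
  obtain c where "\<forall>i\<in>L. m i \<le> c" "\<forall>j\<in>I - L. c \<le> m j"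
  \<comment> \<open>With \<open>L\<close> empty, a lower bound of \<open>m\<close> on
    \<open>I\<close> suffices; if \<open>I\<close> is empty too, \<open>Min\<close> is unspecified
    but both conditions are vacuous.\<close>
  proof (cases "L = {}")
    case True
    then show thesis
      using that[of "Min (m ` I)"] assms(1) by auto
  next
    case False
    then show thesis
      using that[of "Max (m ` L)"] fin L(3) by auto
  qed
  moreover have "card (I - L) \<le> n"
    using L fin assms(2) by (simp add: card_Diff_subset)
  ultimately show thesis
    using L assms by (intro that[of L "I - L" c]) auto
qed

section \<open>The logarithmic bound in a plane\<close>

text \<open>The diagonal parts together cost only the square of \<open>K\<close>, since the squares
  of the two half sums of \<open>g\<close> add up to at most the square of the whole sum. The cross
  terms are linear in \<open>K\<close>: one factor is a half family with doubled lengths, the other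
  consists of segments in two fixed directions, where the bound is 4. Completing the square in
  \<open>K\<^sup>2 + 128 * K\<close> gives the additive 64.\<close>

lemma adj_bound_planar_step:
  fixes e\<^sub>1 e\<^sub>2 :: "'a::euclidean_space" and p m :: "'i \<Rightarrow> real"
  defines "z \<equiv> \<lambda>q i. q i *\<^sub>R (e\<^sub>1 + m i *\<^sub>R e\<^sub>2)"
  assumes fin: "finite L" "finite R" and disj: "L \<inter> R = {}" and K: "0 \<le> K"
    and L: "\<And>q. adj_bound L (z q) K" and R: "\<And>q. adj_bound R (z q) K"
    and mL: "\<And>i. i \<in> L \<Longrightarrow> m i \<le> c" and mR: "\<And>j. j \<in> R \<Longrightarrow> c \<le> m j"
  shows "adj_bound (L \<union> R) (z p) (K + 64)"
proof (rule adj_boundI)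
  fix g :: "'i \<Rightarrow> 'a \<Rightarrow> ennreal"
  assume g: "\<And>i. i \<in> L \<union> R \<Longrightarrow> g i \<in> borel_measurable borel"
  \<comment> \<open>The direction of threshold slope: \<open>L\<close> and \<open>R\<close> lie on
    its two sides, as the comparison of two coplanar segments requires.\<close>
  define u where "u = e\<^sub>1 + c *\<^sub>R e\<^sub>2"
  define A where "A i = seg_avg (z p i) (g i)" for i
  define B where "B i = seg_avg (z (\<lambda>i. 2 * p i) i) (g i)" for i
  define P where "P i = seg_avg ((2 * p i) *\<^sub>R u) (g i)" for i
  define Q where "Q i = seg_avg ((2 * (p i * (m i - c))) *\<^sub>R e\<^sub>2) (g i)" for i
  have meas [measurable]: "A i \<in> borel_measurable borel" "B i \<in> borel_measurable borel"
      "P i \<in> borel_measurable borel" "Q i \<in> borel_measurable borel"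
    if "i \<in> L \<union> R" for i
    unfolding A_def B_def P_def Q_def using g[OF that] by measurable
  have zL: "z p i = p i *\<^sub>R (u - (c - m i) *\<^sub>R e\<^sub>2)" and zR: "z p i = p i *\<^sub>R (u + (m i - c) *\<^sub>R e\<^sub>2)" for i
    unfolding z_def u_def by (simp_all add: algebra_simps)
  have z2: "2 *\<^sub>R z p i = z (\<lambda>i. 2 * p i) i" for i
    unfolding z_def by simp
  have cross: "(\<integral>\<^sup>+x. A i x * A j x \<partial>lborel)
      \<le> 4 * (\<integral>\<^sup>+x. B i x * (P j x + Q j x) \<partial>lborel) + 4 * (\<integral>\<^sup>+x. (P i x + Q i x) * B j x \<partial>lborel)"
    if ij: "i \<in> L" "j \<in> R" for i j
  proof (cases "\<bar>p j\<bar> \<le> \<bar>p i\<bar>")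
    case True
    have "(\<integral>\<^sup>+x. A i x * A j x \<partial>lborel) \<le> 4 * (\<integral>\<^sup>+x. B i x * (P j x + Q j x) \<partial>lborel)"
      unfolding A_def B_def P_def Q_def z2[symmetric] zL[of i] zR[of j]
      using ij mL mR True by (intro nn_integral_seg_avg_cross_le g) auto
    then show ?thesis by (simp add: add_increasing2)
  next
    case False
    \<comment> \<open>If the segment from \<open>R\<close> is the longer one, replacing
      \<open>e\<^sub>2\<close> by \<open>- e\<^sub>2\<close> exchanges the two sides.\<close>
    have zL': "z p i = p i *\<^sub>R (u + (c - m i) *\<^sub>R (- e\<^sub>2))"
      and zR': "z p j = p j *\<^sub>R (u - (m j - c) *\<^sub>R (- e\<^sub>2))"
      and e: "(2 * (p i * (m i - c))) *\<^sub>R e\<^sub>2 = (2 * (p i * (c - m i))) *\<^sub>R (- e\<^sub>2)"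
      unfolding z_def u_def by (simp_all add: algebra_simps)
    have "(\<integral>\<^sup>+x. A j x * A i x \<partial>lborel) \<le> 4 * (\<integral>\<^sup>+x. B j x * (P i x + Q i x) \<partial>lborel)"
      unfolding A_def B_def P_def Q_def z2[symmetric] zL' zR' e
      using ij mL mR False by (intro nn_integral_seg_avg_cross_le g) auto
    then show ?thesis by (simp add: add_increasing mult.commute)
  qed
  let ?G = "\<integral>\<^sup>+x. (\<Sum>i\<in>L \<union> R. g i x)\<^sup>2 \<partial>lborel"
  have SB: "(\<integral>\<^sup>+x. (\<Sum>i\<in>J. B i x)\<^sup>2 \<partial>lborel) \<le> ennreal (K\<^sup>2) * ?G" if "J = L \<or> J = R" for J
    unfolding B_def using that L R fin g by (intro adj_boundD_subset) auto
  have SP: "(\<integral>\<^sup>+x. (\<Sum>i\<in>J. P i x)\<^sup>2 \<partial>lborel) \<le> ennreal (4\<^sup>2) * ?G" if "J = L \<or> J = R" for J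
    unfolding P_def using that fin g by (intro adj_boundD_subset adj_bound_parallel) auto
  have SQ: "(\<integral>\<^sup>+x. (\<Sum>i\<in>J. Q i x)\<^sup>2 \<partial>lborel) \<le> ennreal (4\<^sup>2) * ?G" if "J = L \<or> J = R" for J
    unfolding Q_def using that fin g by (intro adj_boundD_subset adj_bound_parallel) auto
  \<comment> \<open>Each of the parallel families \<open>P\<close> and \<open>Q\<close> contributes
    \<open>K * 4\<close>.\<close>
  have half: "(\<integral>\<^sup>+x. (\<Sum>i\<in>J. B i x) * (\<Sum>i\<in>J'. P i x + Q i x) \<partial>lborel) \<le> 8 * (ennreal K * ?G)"
    if J: "J = L \<or> J = R" "J' = L \<or> J' = R" for J J'
  proof -
    have ms [measurable]: "(\<lambda>x. \<Sum>i\<in>J. B i x) \<in> borel_measurable borel"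
        "(\<lambda>x. \<Sum>i\<in>J'. P i x) \<in> borel_measurable borel"
        "(\<lambda>x. \<Sum>i\<in>J'. Q i x) \<in> borel_measurable borel"
      using J by (auto intro!: borel_measurable_sum meas)
    have "(\<integral>\<^sup>+x. (\<Sum>i\<in>J. B i x) * (\<Sum>i\<in>J'. P i x + Q i x) \<partial>lborel)
        = (\<integral>\<^sup>+x. (\<Sum>i\<in>J. B i x) * (\<Sum>i\<in>J'. P i x) \<partial>lborel)
        + (\<integral>\<^sup>+x. (\<Sum>i\<in>J. B i x) * (\<Sum>i\<in>J'. Q i x) \<partial>lborel)"
      by (simp add: sum.distrib distrib_left nn_integral_add)
    also have "\<dots> \<le> ennreal (K * 4) * ?G + ennreal (K * 4) * ?G"
      using K J by (intro add_mono nn_integral_mult_le SB SP SQ) auto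
    also have "\<dots> = 8 * (ennreal K * ?G)"
    proof -
      have "ennreal (K * 4) * ?G = 4 * (ennreal K * ?G)"
        using K by (simp add: ennreal_mult ac_simps)
      then show ?thesis by (simp flip: distrib_right)
    qed
    finally show ?thesis .
  qed
  have "(\<integral>\<^sup>+x. (\<Sum>i\<in>L. A i x) * (\<Sum>j\<in>R. A j x) \<partial>lborel)
      = (\<Sum>i\<in>L. \<Sum>j\<in>R. \<integral>\<^sup>+x. A i x * A j x \<partial>lborel)"
    by (intro nn_integral_sum_mult_sum) (auto intro: meas)
  also have "\<dots> \<le> (\<Sum>i\<in>L. \<Sum>j\<in>R. 4 * (\<integral>\<^sup>+x. B i x * (P j x + Q j x) \<partial>lborel)
      + 4 * (\<integral>\<^sup>+x. (P i x + Q i x) * B j x \<partial>lborel))"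
    by (intro sum_mono cross)
  also have "\<dots> = 4 * (\<Sum>i\<in>L. \<Sum>j\<in>R. \<integral>\<^sup>+x. B i x * (P j x + Q j x) \<partial>lborel)
      + 4 * (\<Sum>i\<in>L. \<Sum>j\<in>R. \<integral>\<^sup>+x. (P i x + Q i x) * B j x \<partial>lborel)"
    by (simp only: sum.distrib sum_distrib_left)
  also have "\<dots> = 4 * (\<integral>\<^sup>+x. (\<Sum>i\<in>L. B i x) * (\<Sum>j\<in>R. P j x + Q j x) \<partial>lborel)
      + 4 * (\<integral>\<^sup>+x. (\<Sum>i\<in>L. P i x + Q i x) * (\<Sum>j\<in>R. B j x) \<partial>lborel)"
    by (intro arg_cong2[where f = "(+)"] arg_cong[where f = "(*) 4"]
      nn_integral_sum_mult_sum[symmetric]) (auto intro!: meas borel_measurable_add)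
  also have "\<dots> \<le> 4 * (8 * (ennreal K * ?G)) + 4 * (8 * (ennreal K * ?G))"
    using half[of L R] half[of R L] by (intro add_mono mult_left_mono) (auto simp: mult.commute)
  also have "\<dots> = 64 * (ennreal K * ?G)"
    by (simp add: mult.assoc[symmetric] flip: distrib_right)
  finally have AA: "(\<integral>\<^sup>+x. (\<Sum>i\<in>L. A i x) * (\<Sum>j\<in>R. A j x) \<partial>lborel) \<le> 64 * (ennreal K * ?G)" .
  have msA [measurable]: "(\<lambda>x. \<Sum>i\<in>L. A i x) \<in> borel_measurable borel"
      "(\<lambda>x. \<Sum>i\<in>R. A i x) \<in> borel_measurable borel"
      "(\<lambda>x. \<Sum>i\<in>L. g i x) \<in> borel_measurable borel"
      "(\<lambda>x. \<Sum>i\<in>R. g i x) \<in> borel_measurable borel"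
    by (auto intro!: borel_measurable_sum meas g)
  have "(\<integral>\<^sup>+x. (\<Sum>i\<in>L. A i x)\<^sup>2 \<partial>lborel) + (\<integral>\<^sup>+x. (\<Sum>i\<in>R. A i x)\<^sup>2 \<partial>lborel)
      \<le> ennreal (K\<^sup>2) * (\<integral>\<^sup>+x. (\<Sum>i\<in>L. g i x)\<^sup>2 \<partial>lborel)
        + ennreal (K\<^sup>2) * (\<integral>\<^sup>+x. (\<Sum>i\<in>R. g i x)\<^sup>2 \<partial>lborel)"
    unfolding A_def by (intro add_mono adj_boundD L R g) auto
  also have "\<dots> = ennreal (K\<^sup>2) * (\<integral>\<^sup>+x. (\<Sum>i\<in>L. g i x)\<^sup>2 + (\<Sum>i\<in>R. g i x)\<^sup>2 \<partial>lborel)"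
    by (simp add: nn_integral_add distrib_left)
  also have "\<dots> \<le> ennreal (K\<^sup>2) * ?G"
    using fin disj by (intro mult_left_mono nn_integral_mono)
      (auto simp: sum.union_disjoint power2_sum intro: add_increasing2)
  finally have diag: "(\<integral>\<^sup>+x. (\<Sum>i\<in>L. A i x)\<^sup>2 \<partial>lborel) + (\<integral>\<^sup>+x. (\<Sum>i\<in>R. A i x)\<^sup>2 \<partial>lborel)
      \<le> ennreal (K\<^sup>2) * ?G" .
  have "(\<integral>\<^sup>+x. (\<Sum>i\<in>L \<union> R. A i x)\<^sup>2 \<partial>lborel)
      = (\<integral>\<^sup>+x. ((\<Sum>i\<in>L. A i x) + (\<Sum>i\<in>R. A i x))\<^sup>2 \<partial>lborel)"
    using fin disj by (simp add: sum.union_disjoint)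
  also have "\<dots> = (\<integral>\<^sup>+x. (\<Sum>i\<in>L. A i x)\<^sup>2 \<partial>lborel) + (\<integral>\<^sup>+x. (\<Sum>i\<in>R. A i x)\<^sup>2 \<partial>lborel)
      + 2 * (\<integral>\<^sup>+x. (\<Sum>i\<in>L. A i x) * (\<Sum>i\<in>R. A i x) \<partial>lborel)"
    by (rule nn_integral_power2_add) measurable
  also have "\<dots> \<le> ennreal (K\<^sup>2) * ?G + 2 * (64 * (ennreal K * ?G))"
    by (intro add_mono mult_left_mono diag AA) auto
  also have "\<dots> = ennreal (K\<^sup>2 + 128 * K) * ?G"
    using K by (simp add: ennreal_mult distrib_right mult.assoc[symmetric])
  also have "\<dots> \<le> ennreal ((K + 64)\<^sup>2) * ?G"
    using K by (intro mult_right_mono ennreal_leI) (auto simp: power2_sum)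
  finally show "(\<integral>\<^sup>+x. (\<Sum>i\<in>L \<union> R. seg_avg (z p i) (g i) x)\<^sup>2 \<partial>lborel) \<le> ennreal ((K + 64)\<^sup>2) * ?G"
    unfolding A_def .
qed

text \<open>After \<open>k\<close> halvings at most one segment is left, where the trivial bound is
  at most 1; each level adds 64. The lengths \<open>p\<close> stay arbitrary because the step uses
  the halves with other lengths.\<close>

lemma adj_bound_planar_slopes:
  fixes e\<^sub>1 e\<^sub>2 :: "'a::euclidean_space" and p m :: "'i \<Rightarrow> real"
  assumes "finite I" "card I \<le> 2 ^ k"
  shows "adj_bound I (\<lambda>i. p i *\<^sub>R (e\<^sub>1 + m i *\<^sub>R e\<^sub>2)) (1 + 64 * real k)"
  using assms
proof (induction k arbitrary: I p)
  case 0
  then show ?case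
    by (intro adj_bound_mono[OF adj_bound_sqrt_card]) auto
next
  case (Suc k)
  obtain L R c where LR: "L \<inter> R = {}" "I = L \<union> R" "card L \<le> 2 ^ k" "card R \<le> 2 ^ k"
      "\<And>i. i \<in> L \<Longrightarrow> m i \<le> c" "\<And>j. j \<in> R \<Longrightarrow> c \<le> m j"
    by (rule obtain_threshold_split[OF Suc.prems(1), of "2 ^ k" m]) (use Suc.prems(2) in simp, blast)
  have "adj_bound (L \<union> R) (\<lambda>i. p i *\<^sub>R (e\<^sub>1 + m i *\<^sub>R e\<^sub>2)) (1 + 64 * real k + 64)"
    using LR Suc.prems by (intro adj_bound_planar_step[where c = c] Suc.IH) auto
  then show ?case
    using LR(2) by (simp add: algebra_simps)
qed

text \<open>Vectors without \<open>e\<^sub>1\<close> component have no finite slope. They are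
  parallel to \<open>e\<^sub>2\<close> and add 4 to the constant.\<close>

lemma adj_bound_planar:
  fixes e\<^sub>1 e\<^sub>2 :: "'a::euclidean_space" and z :: "'i \<Rightarrow> 'a"
  assumes fin: "finite I" and card: "card I \<le> 2 ^ k" and z: "\<And>i. i \<in> I \<Longrightarrow> z i \<in> span {e\<^sub>1, e\<^sub>2}"
  shows "adj_bound I z (5 + 64 * real k)"
proof -
  have "\<exists>a b. z i = a *\<^sub>R e\<^sub>1 + b *\<^sub>R e\<^sub>2" if "i \<in> I" for i
    using z[OF that] by (auto simp: span_insert span_singleton) (metis diff_add_cancel add.commute)
  then obtain a b where ab: "\<And>i. i \<in> I \<Longrightarrow> z i = a i *\<^sub>R e\<^sub>1 + b i *\<^sub>R e\<^sub>2"
    by metis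
  let ?A = "{i \<in> I. a i \<noteq> 0}" and ?B = "{i \<in> I. a i = 0}"
  have "card ?A \<le> 2 ^ k"
    using card card_mono[OF fin, of ?A] by auto
  then have "adj_bound ?A (\<lambda>i. a i *\<^sub>R (e\<^sub>1 + (b i / a i) *\<^sub>R e\<^sub>2)) (1 + 64 * real k)"
    using fin by (intro adj_bound_planar_slopes) auto
  also have "?this \<longleftrightarrow> adj_bound ?A z (1 + 64 * real k)"
    by (intro adj_bound_cong) (auto simp: ab algebra_simps)
  finally have A: "adj_bound ?A z (1 + 64 * real k)" .
  have "adj_bound ?B (\<lambda>i. b i *\<^sub>R e\<^sub>2) 4"
    using fin by (intro adj_bound_parallel) auto
  also have "?this \<longleftrightarrow> adj_bound ?B z 4"
    by (intro adj_bound_cong) (auto simp: ab)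
  finally have "adj_bound (?A \<union> ?B) z (1 + 64 * real k + 4)"
    using fin by (intro adj_bound_Un A) auto
  also have "?A \<union> ?B = I" by auto
  finally show ?thesis by (simp add: algebra_simps)
qed

section \<open>Unit segments in space\<close>

lemma orthogonal_complement_subset_span_pair:
  fixes v :: "real ^ 3"
  assumes "v \<noteq> 0"
  obtains e\<^sub>1 e\<^sub>2 where "{x. v \<bullet> x = 0} \<subseteq> span {e\<^sub>1, e\<^sub>2}"
proof -
  have "dim {x. v \<bullet> x = 0} = 2"
    using assms by (simp add: dim_hyperplane)
  then obtain B where B: "{x. v \<bullet> x = 0} \<subseteq> span B" "card B = 2"
    using basis_exists[of "{x. v \<bullet> x = 0}"] by metis
  then show thesis
    using that by (auto simp: card_2_iff)
qed

text \<open>Averaging \<open>S\<close> once more along a fixed \<open>v\<close> makes all directions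
  matter only modulo \<open>v\<close>, which puts the problem into a plane. Cauchy-Schwarz over
  \<open>v\<close> costs \<open>card \<Sigma>\<close> at the level of the fourth power of the norm
  of \<open>S\<close>, while the squared norms of the \<open>g v\<close> sum to at most
  \<open>?G\<close>.\<close>

lemma adj_bound_sphere:
  fixes \<Sigma> :: "(real ^ 3) set"
  assumes fin: "finite \<Sigma>" and sphere: "\<Sigma> \<subseteq> sphere 0 1" and card: "card \<Sigma> \<le> 2 ^ k"
  shows "adj_bound \<Sigma> (\<lambda>v. v) (sqrt (2 * sqrt (card \<Sigma>) * (5 + 64 * real k)))"
proof (rule adj_boundI)
  fix g :: "real ^ 3 \<Rightarrow> real ^ 3 \<Rightarrow> ennreal"
  assume g [measurable]: "\<And>v. v \<in> \<Sigma> \<Longrightarrow> g v \<in> borel_measurable borel"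
  define S where "S x = (\<Sum>v\<in>\<Sigma>. seg_avg v (g v) x)" for x
  define K where "K = 5 + 64 * real k"
  have K: "K \<ge> 0" unfolding K_def by simp
  have [measurable]: "S \<in> borel_measurable borel"
    unfolding S_def[abs_def] by measurable
  let ?G = "\<integral>\<^sup>+x. (\<Sum>v\<in>\<Sigma>. g v x)\<^sup>2 \<partial>lborel"
  have avg_S: "(\<integral>\<^sup>+x. (seg_avg v S x)\<^sup>2 \<partial>lborel) \<le> 4 * (ennreal (K\<^sup>2) * ?G)" if v: "v \<in> \<Sigma>" for v
  proof -
    have "norm v = 1" using v sphere by auto
    then have "v \<noteq> 0" by auto
    \<comment> \<open>These components have lengths between 0 and 1, which is why the planar bound
      has to allow segments of all lengths.\<close>
    define u where "u w = w - (v \<bullet> w) *\<^sub>R v" for w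
    have u_perp: "v \<bullet> u w = 0" for w
      using \<open>norm v = 1\<close> by (simp add: u_def inner_diff_right dot_square_norm)
    obtain e\<^sub>1 e\<^sub>2 where e: "{x. v \<bullet> x = 0} \<subseteq> span {e\<^sub>1, e\<^sub>2}"
      using orthogonal_complement_subset_span_pair[OF \<open>v \<noteq> 0\<close>] .
    define T where "T x = (\<Sum>w\<in>\<Sigma>. seg_avg (u w) (g w) x)" for x
    have [measurable]: "T \<in> borel_measurable borel"
      unfolding T_def[abs_def] by measurable
    have "seg_avg v S x \<le> 2 * seg_avg (2 *\<^sub>R v) T x" for x
    proof -
      have "seg_avg v S x = (\<Sum>w\<in>\<Sigma>. seg_avg v (seg_avg w (g w)) x)"
        unfolding S_def by (intro seg_avg_sum) measurable
      also have "\<dots> \<le> (\<Sum>w\<in>\<Sigma>. 2 * seg_avg (2 *\<^sub>R v) (seg_avg (u w) (g w)) x)"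
      proof (rule sum_mono)
        fix w assume w: "w \<in> \<Sigma>"
        have "norm w = 1" using w sphere by auto
        have "\<bar>v \<bullet> w\<bar> \<le> 1"
          using Cauchy_Schwarz_ineq2[of v w] \<open>norm v = 1\<close> \<open>norm w = 1\<close> by simp
        then show "seg_avg v (seg_avg w (g w)) x \<le> 2 * seg_avg (2 *\<^sub>R v) (seg_avg (u w) (g w)) x"
          using w by (intro seg_avg_seg_avg_le[where \<mu> = "v \<bullet> w"]) (auto simp: u_def)
      qed
      also have "\<dots> = 2 * seg_avg (2 *\<^sub>R v) T x"
        unfolding T_def sum_distrib_left[symmetric]
        by (intro arg_cong[where f = "(*) 2"] seg_avg_sum[symmetric]) measurable
      finally show ?thesis .
    qed
    then have "(\<integral>\<^sup>+x. (seg_avg v S x)\<^sup>2 \<partial>lborel) \<le> (\<integral>\<^sup>+x. (2 * seg_avg (2 *\<^sub>R v) T x)\<^sup>2 \<partial>lborel)"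
      by (intro nn_integral_mono power_mono_ennreal)
    also have "\<dots> = 4 * (\<integral>\<^sup>+x. (seg_avg (2 *\<^sub>R v) T x)\<^sup>2 \<partial>lborel)"
      by (simp add: power_mult_distrib nn_integral_cmult)
    also have "\<dots> \<le> 4 * (\<integral>\<^sup>+x. (T x)\<^sup>2 \<partial>lborel)"
      by (intro mult_left_mono nn_integral_seg_avg_power2_le) auto
    also have "(\<integral>\<^sup>+x. (T x)\<^sup>2 \<partial>lborel) \<le> ennreal (K\<^sup>2) * ?G"
      unfolding T_def K_def using e u_perp g
      by (intro adj_boundD adj_bound_planar[OF fin card]) auto
    finally show ?thesis by (simp add: mult_left_mono)
  qed
  have avg_gS: "(\<integral>\<^sup>+x. g v x * seg_avg v S x \<partial>lborel)\<^sup>2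
      \<le> (\<integral>\<^sup>+x. (g v x)\<^sup>2 \<partial>lborel) * (4 * (ennreal (K\<^sup>2) * ?G))" if v: "v \<in> \<Sigma>" for v
    using v by (intro order_trans[OF Cauchy_Schwarz_nn_integral] mult_left_mono avg_S) auto
  have "(\<integral>\<^sup>+x. (S x)\<^sup>2 \<partial>lborel) = (\<integral>\<^sup>+x. (\<Sum>v\<in>\<Sigma>. seg_avg v (g v) x * S x) \<partial>lborel)"
    by (simp add: power2_eq_square S_def[symmetric] flip: sum_distrib_right)
  also have "\<dots> = (\<Sum>v\<in>\<Sigma>. \<integral>\<^sup>+x. seg_avg v (g v) x * S x \<partial>lborel)"
    by (intro nn_integral_sum) measurable
  also have "\<dots> = (\<Sum>v\<in>\<Sigma>. \<integral>\<^sup>+x. g v x * seg_avg v S x \<partial>lborel)"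
    by (intro sum.cong seg_avg_selfadjoint[symmetric]) auto
  finally have "(\<integral>\<^sup>+x. (S x)\<^sup>2 \<partial>lborel)\<^sup>2
      \<le> of_nat (card \<Sigma>) * (\<Sum>v\<in>\<Sigma>. (\<integral>\<^sup>+x. g v x * seg_avg v S x \<partial>lborel)\<^sup>2)"
    using power2_sum_le_card_mult[OF fin] by simp
  also have "\<dots> \<le> of_nat (card \<Sigma>) *
      (\<Sum>v\<in>\<Sigma>. (\<integral>\<^sup>+x. (g v x)\<^sup>2 \<partial>lborel) * (4 * (ennreal (K\<^sup>2) * ?G)))"
    by (intro mult_left_mono sum_mono avg_gS) auto
  also have "\<dots> = of_nat (card \<Sigma>) *
      ((\<integral>\<^sup>+x. (\<Sum>v\<in>\<Sigma>. (g v x)\<^sup>2) \<partial>lborel) * (4 * (ennreal (K\<^sup>2) * ?G)))"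
    by (subst nn_integral_sum) (auto simp: sum_distrib_right)
  also have "\<dots> \<le> of_nat (card \<Sigma>) * (?G * (4 * (ennreal (K\<^sup>2) * ?G)))"
    using fin by (intro mult_left_mono mult_right_mono nn_integral_mono sum_power2_le_power2_sum) auto
  also have "\<dots> = (ennreal (2 * sqrt (card \<Sigma>) * K) * ?G)\<^sup>2"
  proof -
    have "(ennreal (2 * sqrt (card \<Sigma>) * K))\<^sup>2 = ennreal ((2 * sqrt (card \<Sigma>) * K)\<^sup>2)"
      using K by (intro ennreal_power) auto
    also have "(2 * sqrt (card \<Sigma>) * K)\<^sup>2 = real (card \<Sigma>) * (4 * K\<^sup>2)"
      by (simp add: power_mult_distrib)
    also have "ennreal \<dots> = of_nat (card \<Sigma>) * (4 * ennreal (K\<^sup>2))"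
      by (simp add: ennreal_mult ennreal_of_nat_eq_real_of_nat)
    finally show ?thesis
      by (simp add: power_mult_distrib power2_eq_square[of ?G] ac_simps)
  qed
  finally have "(\<integral>\<^sup>+x. (S x)\<^sup>2 \<partial>lborel) \<le> ennreal (2 * sqrt (card \<Sigma>) * K) * ?G"
    by (rule ennreal_le_of_power2_le)
  then show "(\<integral>\<^sup>+x. (\<Sum>v\<in>\<Sigma>. seg_avg v (g v) x)\<^sup>2 \<partial>lborel)
      \<le> ennreal ((sqrt (2 * sqrt (card \<Sigma>) * (5 + 64 * real k)))\<^sup>2) * ?G"
    using K unfolding S_def K_def by simp
qed

section \<open>From the dual inequality to the maximal function\<close>

text \<open>The maximal function \<open>M\<close> is split into pieces \<open>g i\<close> living
  where direction \<open>i\<close> attains the maximum. Self-adjointness writes the integral of its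
  square as a pairing of the dual operator with \<open>f\<close>; Cauchy-Schwarz gives
  \<open>?X\<^sup>2\<close> \<le> \<open>?X * (ennreal (K\<^sup>2) * ?Y)\<close>, and
  \<open>?X\<close> cancels.\<close>

lemma maximal_bound_of_adj_bound:
  fixes z :: "'i \<Rightarrow> 'a::euclidean_space"
  assumes fin: "finite I" and ne: "I \<noteq> {}" and bound: "adj_bound I z K" and K: "0 < K"
    and f [measurable]: "f \<in> borel_measurable borel"
  shows "(\<integral>\<^sup>+x. (Max ((\<lambda>i. seg_avg (z i) f x) ` I))\<^sup>2 \<partial>lborel)
    \<le> ennreal (K\<^sup>2) * (\<integral>\<^sup>+x. (f x)\<^sup>2 \<partial>lborel)"
proof (cases "(\<integral>\<^sup>+x. (f x)\<^sup>2 \<partial>lborel) = top")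
  case True
  then show ?thesis using K by (simp add: ennreal_mult_top)
next
  case False
  define M where "M x = Max ((\<lambda>i. seg_avg (z i) f x) ` I)" for x
  have [measurable]: "M \<in> borel_measurable borel"
    unfolding M_def[abs_def] using fin by measurable
  \<comment> \<open>Ties are shared equally among all maximising indices, so no measurable selection
    has to be made.\<close>
  define \<phi> :: "'i \<Rightarrow> 'a \<Rightarrow> ennreal" where "\<phi> i x = (if seg_avg (z i) f x = M x then 1 else 0)" for i x
  have [measurable]: "\<phi> i \<in> borel_measurable borel" for i
    unfolding \<phi>_def[abs_def] by measurable
  define n where "n x = (\<Sum>i\<in>I. \<phi> i x)" for x
  have [measurable]: "n \<in> borel_measurable borel"
    unfolding n_def[abs_def] by measurable
  define g where "g i x = M x * (\<phi> i x / n x)" for i x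
  have g [measurable]: "g i \<in> borel_measurable borel" for i
    unfolding g_def[abs_def] by measurable
  have n: "n x \<noteq> 0" "n x \<noteq> top" for x
  proof -
    have "M x \<in> (\<lambda>i. seg_avg (z i) f x) ` I"
      unfolding M_def using fin ne by (intro Max_in) auto
    then show "n x \<noteq> 0"
      unfolding n_def using fin by (force simp: \<phi>_def)
    show "n x \<noteq> top"
      unfolding n_def using fin by (auto simp: \<phi>_def)
  qed
  have sum_g: "(\<Sum>i\<in>I. g i x) = M x" for x
  proof -
    have "(\<Sum>i\<in>I. g i x) = M x * (n x / n x)"
      unfolding g_def n_def divide_ennreal_def by (simp only: sum_distrib_left sum_distrib_right)
    then show ?thesis using n[of x] by (simp add: ennreal_divide_self less_top)
  qed
  have g_M: "g i x * seg_avg (z i) f x = g i x * M x" for i x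
    unfolding g_def \<phi>_def by simp
  let ?X = "\<integral>\<^sup>+x. (M x)\<^sup>2 \<partial>lborel" and ?Y = "\<integral>\<^sup>+x. (f x)\<^sup>2 \<partial>lborel"
  \<comment> \<open>A crude bound, to make \<open>?X\<close> finite for the final
    cancellation.\<close>
  have "?X \<le> (\<integral>\<^sup>+x. (\<Sum>i\<in>I. (seg_avg (z i) f x)\<^sup>2) \<partial>lborel)"
  proof (rule nn_integral_mono)
    fix x
    have "M x \<in> (\<lambda>i. seg_avg (z i) f x) ` I"
      unfolding M_def using fin ne by (intro Max_in) auto
    then show "(M x)\<^sup>2 \<le> (\<Sum>i\<in>I. (seg_avg (z i) f x)\<^sup>2)"
      using fin by (auto intro!: member_le_sum[where f = "\<lambda>i. (seg_avg (z i) f x)\<^sup>2"])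
  qed
  also have "\<dots> = (\<Sum>i\<in>I. \<integral>\<^sup>+x. (seg_avg (z i) f x)\<^sup>2 \<partial>lborel)"
    by (intro nn_integral_sum) measurable
  also have "\<dots> \<le> (\<Sum>i\<in>I. ?Y)"
    by (intro sum_mono nn_integral_seg_avg_power2_le f)
  also have "\<dots> < top"
    using False by (simp add: ennreal_mult_less_top less_top of_nat_less_top)
  finally have X_fin: "?X \<noteq> top" by simp
  have "?X = (\<integral>\<^sup>+x. (\<Sum>i\<in>I. g i x * seg_avg (z i) f x) \<partial>lborel)"
    by (simp add: g_M power2_eq_square sum_g flip: sum_distrib_right)
  also have "\<dots> = (\<Sum>i\<in>I. \<integral>\<^sup>+x. g i x * seg_avg (z i) f x \<partial>lborel)"
    by (intro nn_integral_sum) measurable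
  also have "\<dots> = (\<Sum>i\<in>I. \<integral>\<^sup>+x. seg_avg (z i) (g i) x * f x \<partial>lborel)"
    by (intro sum.cong refl seg_avg_selfadjoint) measurable
  also have "\<dots> = (\<integral>\<^sup>+x. (\<Sum>i\<in>I. seg_avg (z i) (g i) x) * f x \<partial>lborel)"
    unfolding sum_distrib_right by (intro nn_integral_sum[symmetric]) measurable
  finally have "?X\<^sup>2 = (\<integral>\<^sup>+x. (\<Sum>i\<in>I. seg_avg (z i) (g i) x) * f x \<partial>lborel)\<^sup>2"
    by simp
  also have "\<dots> \<le> (\<integral>\<^sup>+x. (\<Sum>i\<in>I. seg_avg (z i) (g i) x)\<^sup>2 \<partial>lborel) * ?Y"
    by (rule Cauchy_Schwarz_nn_integral) measurable
  also have "\<dots> \<le> (ennreal (K\<^sup>2) * (\<integral>\<^sup>+x. (\<Sum>i\<in>I. g i x)\<^sup>2 \<partial>lborel)) * ?Y"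
    by (intro mult_right_mono adj_boundD[OF bound] g) auto
  also have "\<dots> = ?X * (ennreal (K\<^sup>2) * ?Y)"
    by (simp add: sum_g ac_simps)
  finally have "?X * ?X \<le> ?X * (ennreal (K\<^sup>2) * ?Y)"
    by (simp add: power2_eq_square)
  then have "?X \<le> ennreal (K\<^sup>2) * ?Y"
    using X_fin by (cases "?X = 0") (auto simp: ennreal_mult_le_mult_iff)
  then show ?thesis
    unfolding M_def .
qed

section \<open>The maximal operator on Lebesgue measurable functions\<close>

text \<open>Translates of a null set are null, so Fubini applies to a Borel null set containing the
  exceptions. This lets a function be replaced by a Borel representative inside line
  integrals.\<close>

lemma AE_lborel_along_segments:
  fixes v :: "'a::euclidean_space"
  assumes "AE y in lborel. P y"
  shows "AE x in lborel. AE t in lborel. P (x + t *\<^sub>R v)"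
proof -
  obtain N where N: "{y \<in> space lborel. \<not> P y} \<subseteq> N" "emeasure lborel N = 0" "N \<in> sets lborel"
    using assms by (rule AE_E)
  have [measurable]: "N \<in> sets borel" using N by simp
  have "(\<integral>\<^sup>+x. \<integral>\<^sup>+t. indicator N (x + t *\<^sub>R v) \<partial>lborel \<partial>lborel)
      = (\<integral>\<^sup>+t. \<integral>\<^sup>+x. indicator N (x + t *\<^sub>R v) \<partial>lborel \<partial>lborel)"
    by (rule lborel_pair.Fubini') measurable
  also have "\<dots> = 0"
    by (subst nn_integral_lborel_translate) (use N in auto)
  finally have "AE x in lborel. (\<integral>\<^sup>+t. indicator N (x + t *\<^sub>R v) \<partial>lborel) = (0::ennreal)"
    by (subst (asm) nn_integral_0_iff_AE) measurable
  then show ?thesis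
  proof eventually_elim
    case (elim x)
    then have "AE t in lborel. indicator N (x + t *\<^sub>R v) = (0::ennreal)"
      by (subst (asm) nn_integral_0_iff_AE) measurable
    then show ?case
      by eventually_elim (use N(1) in \<open>auto simp: indicator_eq_0_iff\<close>)
  qed
qed

text \<open>A Lebesgue measurable function may restrict badly to a line; here measurability of
  \<open>f\<close> comes from agreement with \<open>g\<close> outside a null set, by
  completeness.\<close>

lemma set_lebesgue_integral_eq_AE:
  fixes f g :: "real \<Rightarrow> real"
  assumes "g \<in> borel_measurable borel" "AE t in lborel. f t = g t"
  shows "(LINT t:{a..b}|lebesgue. f t) = (LINT t:{a..b}|lborel. g t)"
proof -
  have AE: "AE t in lebesgue. f t = g t"
    using assms(2) by (rule AE_completion)
  have g: "g \<in> borel_measurable lebesgue"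
    using assms(1) by (simp add: measurable_completion)
  have f: "f \<in> borel_measurable lebesgue"
    by (rule borel_measurable_AE[OF g]) (use AE in eventually_elim, simp)
  have "(LINT t:{a..b}|lebesgue. f t) = (LINT t:{a..b}|lebesgue. g t)"
    unfolding set_lebesgue_integral_def
    by (rule integral_cong_AE)
       (use f g AE in \<open>auto intro!: borel_measurable_times borel_measurable_indicator elim: eventually_mono\<close>)
  also have "\<dots> = (LINT t:{a..b}|lborel. g t)"
    unfolding set_lebesgue_integral_def using assms(1)
    by (intro integral_completion) measurable
  finally show ?thesis .
qed

lemma abs_set_lebesgue_integral_le_seg_avg:
  fixes f :: "'a::euclidean_space \<Rightarrow> real"
  assumes [measurable]: "f \<in> borel_measurable borel"
  shows "ennreal \<bar>LINT t:{-1/2..1/2}|lborel. f (x + t *\<^sub>R v)\<bar> \<le> seg_avg v (\<lambda>y. ennreal \<bar>f y\<bar>) x"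
proof (cases "set_integrable lborel {-1/2..1/2} (\<lambda>t. f (x + t *\<^sub>R v))")
  case True
  have "ennreal \<bar>LINT t:{-1/2..1/2}|lborel. f (x + t *\<^sub>R v)\<bar>
      \<le> (\<integral>\<^sup>+t. ennreal (norm (indicator {-1/2..1/2} t *\<^sub>R f (x + t *\<^sub>R v))) \<partial>lborel)"
    using integral_norm_bound_ennreal[OF True[unfolded set_integrable_def]]
    unfolding set_lebesgue_integral_def by simp
  also have "\<dots> = seg_avg v (\<lambda>y. ennreal \<bar>f y\<bar>) x"
    unfolding seg_avg_def by (intro nn_integral_cong) (simp add: indicator_def)
  finally show ?thesis .
next
  case False
  \<comment> \<open>The Bochner integral then has the default value 0.\<close>
  then show ?thesis
    by (simp add: set_lebesgue_integral_def set_integrable_def not_integrable_integral_eq)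
qed

text \<open>A Borel representative \<open>f\<close> of \<open>F\<close> changes the maximal function
  only on a null set, because \<open>\<Sigma>\<close> is finite, and the maximal function of
  \<open>f\<close> is dominated by that of its absolute value in \<open>ennreal\<close>.\<close>

lemma M0_bound_of_adj_bound:
  fixes \<Sigma> :: "(real ^ 3) set"
  assumes fin: "finite \<Sigma>" and ne: "\<Sigma> \<noteq> {}" and bound: "adj_bound \<Sigma> (\<lambda>v. v) K" and K: "0 < K"
    and F: "F \<in> L2"
  shows "M0 \<Sigma> F \<in> L2 \<and> L2_norm (M0 \<Sigma> F) \<le> K * L2_norm F"
proof -
  obtain f where f [measurable]: "f \<in> borel_measurable borel" and F_f: "AE x in lborel. F x = f x"
    using F completion_ex_borel_measurable_real[of F lborel] by (auto simp: L2_def)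
  define m where "m x = Max ((\<lambda>v. \<bar>LINT t:{-1/2..1/2}|lborel. f (x + t *\<^sub>R v)\<bar>) ` \<Sigma>)" for x
  have m [measurable]: "m \<in> borel_measurable borel"
    unfolding m_def[abs_def] set_lebesgue_integral_def using fin by measurable
  have m_nonneg: "0 \<le> m x" for x
  proof -
    have "m x \<in> (\<lambda>v. \<bar>LINT t:{-1/2..1/2}|lborel. f (x + t *\<^sub>R v)\<bar>) ` \<Sigma>"
      unfolding m_def using fin ne by (intro Max_in) auto
    then show ?thesis by auto
  qed
  have "AE x in lborel. \<forall>v\<in>\<Sigma>. AE t in lborel. F (x + t *\<^sub>R v) = f (x + t *\<^sub>R v)"
    using fin AE_lborel_along_segments[OF F_f] by (intro AE_finite_allI) auto
  then have M0_m: "AE x in lborel. M0 \<Sigma> F x = m x"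
  proof eventually_elim
    case (elim x)
    show ?case
      unfolding M0_def m_def
    proof (intro arg_cong[where f = Max] image_cong refl arg_cong[where f = abs])
      fix v assume "v \<in> \<Sigma>"
      then show "(LINT t:{-1/2..1/2}|lebesgue. F (x + t *\<^sub>R v)) = (LINT t:{-1/2..1/2}|lborel. f (x + t *\<^sub>R v))"
        using elim by (intro set_lebesgue_integral_eq_AE) auto
    qed
  qed
  have nn_F: "(\<integral>\<^sup>+x. ennreal ((F x)\<^sup>2) \<partial>lebesgue) = (\<integral>\<^sup>+x. (ennreal \<bar>f x\<bar>)\<^sup>2 \<partial>lborel)"
    unfolding nn_integral_completion using F_f
    by (intro nn_integral_cong_AE) (auto simp: ennreal_power elim: eventually_mono)
  have nn_M0: "(\<integral>\<^sup>+x. ennreal ((M0 \<Sigma> F x)\<^sup>2) \<partial>lebesgue) = (\<integral>\<^sup>+x. (ennreal (m x))\<^sup>2 \<partial>lborel)"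
    unfolding nn_integral_completion using M0_m
    by (intro nn_integral_cong_AE) (auto simp: ennreal_power m_nonneg elim: eventually_mono)
  have "(\<integral>\<^sup>+x. (ennreal (m x))\<^sup>2 \<partial>lborel)
      \<le> (\<integral>\<^sup>+x. (Max ((\<lambda>v. seg_avg v (\<lambda>y. ennreal \<bar>f y\<bar>) x) ` \<Sigma>))\<^sup>2 \<partial>lborel)"
  proof (intro nn_integral_mono power_mono_ennreal)
    fix x
    have "m x \<in> (\<lambda>v. \<bar>LINT t:{-1/2..1/2}|lborel. f (x + t *\<^sub>R v)\<bar>) ` \<Sigma>"
      unfolding m_def using fin ne by (intro Max_in) auto
    then obtain v where v: "v \<in> \<Sigma>" "m x = \<bar>LINT t:{-1/2..1/2}|lborel. f (x + t *\<^sub>R v)\<bar>"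
      by auto
    have "ennreal (m x) \<le> seg_avg v (\<lambda>y. ennreal \<bar>f y\<bar>) x"
      unfolding v(2) by (rule abs_set_lebesgue_integral_le_seg_avg[OF f])
    also have "\<dots> \<le> Max ((\<lambda>v. seg_avg v (\<lambda>y. ennreal \<bar>f y\<bar>) x) ` \<Sigma>)"
      using fin v(1) by (intro Max_ge) auto
    finally show "ennreal (m x) \<le> Max ((\<lambda>v. seg_avg v (\<lambda>y. ennreal \<bar>f y\<bar>) x) ` \<Sigma>)" .
  qed
  also have "\<dots> \<le> ennreal (K\<^sup>2) * (\<integral>\<^sup>+x. (ennreal \<bar>f x\<bar>)\<^sup>2 \<partial>lborel)"
    by (rule maximal_bound_of_adj_bound[OF fin ne bound K]) measurable
  finally have le: "(\<integral>\<^sup>+x. ennreal ((M0 \<Sigma> F x)\<^sup>2) \<partial>lebesgue)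
      \<le> ennreal (K\<^sup>2) * (\<integral>\<^sup>+x. ennreal ((F x)\<^sup>2) \<partial>lebesgue)"
    unfolding nn_F nn_M0 .
  have intF: "integrable lebesgue (\<lambda>x. (F x)\<^sup>2)"
    using F by (simp add: L2_def)
  have nnF: "(\<integral>\<^sup>+x. ennreal ((F x)\<^sup>2) \<partial>lebesgue) = ennreal (\<integral>x. (F x)\<^sup>2 \<partial>lebesgue)"
    by (rule nn_integral_eq_integral[OF intF]) simp
  have "m \<in> borel_measurable lebesgue"
    using m by (simp add: measurable_completion)
  then have M0_meas [measurable]: "M0 \<Sigma> F \<in> borel_measurable lebesgue"
    by (rule borel_measurable_AE) (use AE_completion[OF M0_m] in eventually_elim, simp)
  \<comment> \<open>Integrability comes from the estimate itself, whose right-hand side is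
    finite.\<close>
  have intM: "integrable lebesgue (\<lambda>x. (M0 \<Sigma> F x)\<^sup>2)"
    using le unfolding integrable_iff_bounded nnF
    by (auto intro: le_less_trans simp: ennreal_mult_less_top)
  have "ennreal (\<integral>x. (M0 \<Sigma> F x)\<^sup>2 \<partial>lebesgue) \<le> ennreal (K\<^sup>2 * (\<integral>x. (F x)\<^sup>2 \<partial>lebesgue))"
    using le nn_integral_eq_integral[OF intM] unfolding nnF by (simp add: ennreal_mult)
  then have "(\<integral>x. (M0 \<Sigma> F x)\<^sup>2 \<partial>lebesgue) \<le> K\<^sup>2 * (\<integral>x. (F x)\<^sup>2 \<partial>lebesgue)"
    by (simp add: ennreal_le_iff)
  then have "L2_norm (M0 \<Sigma> F) \<le> sqrt (K\<^sup>2 * (\<integral>x. (F x)\<^sup>2 \<partial>lebesgue))"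
    unfolding L2_norm_def by simp
  also have "\<dots> = K * L2_norm F"
    using K unfolding L2_norm_def by (simp add: real_sqrt_mult)
  finally show ?thesis
    using intM M0_meas by (simp add: L2_def)
qed

section \<open>The numerical constant and the conclusion\<close>

text \<open>The dual bound grows like the fourth root of \<open>N\<close> times the square root of
  its logarithm. As \<open>ln (real N)\<close> \<ge> 1/2, that square root is at most a constant
  times the logarithm.\<close>

lemma adj_bound_constant_le:
  fixes N :: nat
  assumes "N \<ge> 2"
  obtains k where "N \<le> 2 ^ k"
    "sqrt (2 * sqrt N * (5 + 64 * real k)) \<le> 33 * real N powr (1 / 4) * ln (real N)"
proof -
  define k where "k = nat \<lceil>log 2 (real N)\<rceil>"
  have log1: "log 2 (real N) \<ge> 1" using assms by simp
  have "real N = 2 powr log 2 (real N)" using assms by simp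
  also have "\<dots> \<le> 2 powr real k" unfolding k_def by (intro powr_mono real_nat_ceiling_ge) auto
  also have "\<dots> = 2 ^ k" by (simp add: powr_realpow)
  finally have N_le: "N \<le> 2 ^ k" by simp
  \<comment> \<open>Rounding up adds at most 1, which is at most \<open>log 2 (real N)\<close>;
    hence 133 = 5 + 64 * 2 below.\<close>
  have "real k \<le> 2 * log 2 (real N)"
    using log1 unfolding k_def by linarith
  then have "5 + 64 * real k \<le> 133 * log 2 (real N)" using log1 by linarith
  also have "\<dots> = 133 * (ln (real N) / ln 2)" by (simp add: log_def)
  also have "\<dots> \<le> 266 * ln (real N)"
  proof -
    have "ln (2::real) \<ge> 1/2" using ln2_ge_two_thirds by simp
    then have "ln (real N) / ln 2 \<le> ln (real N) / (1/2)"
      using assms by (intro divide_left_mono) auto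
    then show ?thesis by simp
  qed
  also have "\<dots> \<le> 266 * (2 * (ln (real N))\<^sup>2)"
  proof -
    have "ln (real N) \<ge> ln 2" using assms by simp
    then have "ln (real N) \<ge> 1/2" using ln2_ge_two_thirds by linarith
    then have "1 * ln (real N) \<le> (2 * ln (real N)) * ln (real N)"
      by (intro mult_right_mono) auto
    then show ?thesis by (simp add: power2_eq_square)
  qed
  finally have "2 * sqrt N * (5 + 64 * real k) \<le> 2 * sqrt N * (266 * (2 * (ln (real N))\<^sup>2))"
    by (intro mult_left_mono) auto
  also have "\<dots> = 1064 * (sqrt N * (ln (real N))\<^sup>2)" by simp
  \<comment> \<open>33 is the least integer whose square, 1089, reaches 1064.\<close>
  also have "\<dots> \<le> 33\<^sup>2 * (sqrt N * (ln (real N))\<^sup>2)"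
    by (intro mult_right_mono) auto
  also have "\<dots> = (33 * real N powr (1 / 4) * ln (real N))\<^sup>2"
  proof -
    have "(real N powr (1 / 4))\<^sup>2 = sqrt N"
      using assms by (simp add: power2_eq_square powr_half_sqrt flip: powr_add)
    then show ?thesis by (simp add: power_mult_distrib)
  qed
  finally have "sqrt (2 * sqrt N * (5 + 64 * real k)) \<le> 33 * real N powr (1 / 4) * ln (real N)"
    using assms by (intro real_le_lsqrt) auto
  with N_le show thesis by (rule that)
qed

theorem theorem1p1:
  "\<exists>C::real. \<forall>(N::nat) (\<Sigma> :: (real ^ 3) set) (F :: real ^ 3 \<Rightarrow> real).
     N \<ge> 2 \<longrightarrow> finite \<Sigma> \<longrightarrow> \<Sigma> \<subseteq> sphere 0 1 \<longrightarrow> card \<Sigma> = N \<longrightarrow> F \<in> L2 \<longrightarrow>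
       M0 \<Sigma> F \<in> L2 \<and>
       L2_norm (M0 \<Sigma> F) \<le> C * real N powr (1 / 4) * ln (real N) * L2_norm F"
proof (intro exI[of _ 33] allI impI)
  fix N :: nat and \<Sigma> :: "(real ^ 3) set" and F :: "real ^ 3 \<Rightarrow> real"
  assume N: "N \<ge> 2" and \<Sigma>: "finite \<Sigma>" "\<Sigma> \<subseteq> sphere 0 1" "card \<Sigma> = N" and F: "F \<in> L2"
  obtain k where k: "N \<le> 2 ^ k"
    and K: "sqrt (2 * sqrt N * (5 + 64 * real k)) \<le> 33 * real N powr (1 / 4) * ln (real N)"
    using adj_bound_constant_le[OF N] .
  have "adj_bound \<Sigma> (\<lambda>v. v) (33 * real N powr (1 / 4) * ln (real N))"
    using adj_bound_sphere[of \<Sigma> k] \<Sigma> k K by (auto intro: adj_bound_mono)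
  then show "M0 \<Sigma> F \<in> L2 \<and>
      L2_norm (M0 \<Sigma> F) \<le> 33 * real N powr (1 / 4) * ln (real N) * L2_norm F"
    using \<Sigma> N F by (intro M0_bound_of_adj_bound) auto
qed

end
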